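(* Let $R$ be a ring. The following statements are equivalent: (1) $R$ is semiprime and right endoartinian; (2) $R$ is semisimple; (3) $R\cong\prod_{i=1}^n M_{n_i}(D_i)$ (a finite product of matrix rings), where each $D_i$ is a division ring; (4) $R$ is right hereditary and $\operatorname{soc}(R_R)=R$ is of finite length.
   Context: Rings are associative with unity. A right $R$-module $M$ is endoartinian if every descending chain $\operatorname{Im}(f_1)\supseteq\operatorname{Im}(f_2)\supseteq\cdots$ of images of endomorphisms $f_i\in\operatorname{End}_R(M)$ stabilizes. A ring $R$ is right endoartinian if the right module $R_R$ is endoartinian. A ring is semiprime if its zero ideal is semiprime, i.e. $J^2=0$ implies $J=0$ for every ideal $J$. $\operatorname{soc}(R_R)$ is the socle of the right module $R_R$. A ring is right hereditary if every right ideal is projective. *)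

theory Defs
  imports "HOL.Hull" "HOL-Algebra.QuotRing" "HOL-Algebra.Ideal_Product"
    "HOL-Algebra.Chinese_Remainder" "Jordan_Normal_Form.Matrix"
begin

section \<open>Right modules\<close>

text \<open>
  The module locale of HOL-Algebra is restricted to commutative rings. A right module is
  represented here with the same record; its field \<open>smult\<close> takes the scalar first, so
  \<open>a \<odot>\<^bsub>M\<^esub> x\<close> stands for the right action $x a$, and associativity
  reads \<open>x (a b) = (x a) b\<close>. The library predicate \<open>submodule\<close> requires only an additive
  subgroup closed under \<open>smult\<close>, so it is the right notion on either side.
\<close>

locale right_module = R?: ring R + M?: abelian_group M
  for R :: "('a, 'm) ring_scheme" (structure)
    and M :: "('a, 'b, 'n) module_scheme" (structure) +
  assumes smult_closed [simp, intro]: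
      "\<lbrakk>a \<in> carrier R; x \<in> carrier M\<rbrakk> \<Longrightarrow> a \<odot>\<^bsub>M\<^esub> x \<in> carrier M"
    and smult_l_distr:
      "\<lbrakk>a \<in> carrier R; b \<in> carrier R; x \<in> carrier M\<rbrakk> \<Longrightarrow>
        (a \<oplus>\<^bsub>R\<^esub> b) \<odot>\<^bsub>M\<^esub> x = a \<odot>\<^bsub>M\<^esub> x \<oplus>\<^bsub>M\<^esub> b \<odot>\<^bsub>M\<^esub> x"
    and smult_r_distr:
      "\<lbrakk>a \<in> carrier R; x \<in> carrier M; y \<in> carrier M\<rbrakk> \<Longrightarrow>
        a \<odot>\<^bsub>M\<^esub> (x \<oplus>\<^bsub>M\<^esub> y) = a \<odot>\<^bsub>M\<^esub> x \<oplus>\<^bsub>M\<^esub> a \<odot>\<^bsub>M\<^esub> y"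
    and smult_assoc_right:
      "\<lbrakk>a \<in> carrier R; b \<in> carrier R; x \<in> carrier M\<rbrakk> \<Longrightarrow>
        (a \<otimes>\<^bsub>R\<^esub> b) \<odot>\<^bsub>M\<^esub> x = b \<odot>\<^bsub>M\<^esub> (a \<odot>\<^bsub>M\<^esub> x)"
    and smult_one [simp]: "x \<in> carrier M \<Longrightarrow> \<one>\<^bsub>R\<^esub> \<odot>\<^bsub>M\<^esub> x = x"

definition right_regular :: "('a, 'm) ring_scheme \<Rightarrow> ('a, 'a) module" where
  "right_regular R =
    \<lparr>carrier = carrier R, monoid.mult = monoid.mult R, one = one R, zero = zero R, add = add R,
     smult = (\<lambda>a x. x \<otimes>\<^bsub>R\<^esub> a)\<rparr>"

lemma right_module_right_regular:
  assumes "ring R"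
  shows "right_module R (right_regular R)"
proof -
  interpret ring R by fact
  have "abelian_group (right_regular R)"
    unfolding right_regular_def
    by (rule abelian_groupI) (use a_ac(1) a_comm l_neg in \<open>auto intro!: bexI[of _ "a_inv R _"]\<close>)
  then show ?thesis
    by (auto simp: right_module_def right_module_axioms_def right_regular_def
        ring_axioms l_distr r_distr m_assoc)
qed

definition module_hom ::
  "('a, 'm) ring_scheme \<Rightarrow> ('a, 'b, 'n) module_scheme \<Rightarrow> ('a, 'c, 'k) module_scheme \<Rightarrow> ('b \<Rightarrow> 'c) set"
  where "module_hom R M N =
    {f \<in> carrier M \<rightarrow> carrier N.
      (\<forall>x\<in>carrier M. \<forall>y\<in>carrier M. f (x \<oplus>\<^bsub>M\<^esub> y) = f x \<oplus>\<^bsub>N\<^esub> f y) \<and>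
      (\<forall>a\<in>carrier R. \<forall>x\<in>carrier M. f (a \<odot>\<^bsub>M\<^esub> x) = a \<odot>\<^bsub>N\<^esub> f x)}"

abbreviation module_End ::
  "('a, 'm) ring_scheme \<Rightarrow> ('a, 'b, 'n) module_scheme \<Rightarrow> ('b \<Rightarrow> 'b) set"
  where "module_End R M \<equiv> module_hom R M M"

definition simple_module :: "('a, 'm) ring_scheme \<Rightarrow> ('a, 'b, 'n) module_scheme \<Rightarrow> bool" where
  "simple_module R M \<longleftrightarrow>
    right_module R M \<and> carrier M \<noteq> {\<zero>\<^bsub>M\<^esub>} \<and>
    (\<forall>N. submodule N R M \<longrightarrow> N = {\<zero>\<^bsub>M\<^esub>} \<or> N = carrier M)"

definition simple_submodules ::
  "('a, 'm) ring_scheme \<Rightarrow> ('a, 'b, 'n) module_scheme \<Rightarrow> 'b set set" where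
  "simple_submodules R M = {S. submodule S R M \<and> simple_module R (M\<lparr>carrier := S\<rparr>)}"

text \<open>The sum of a (possibly infinite) set of submodules: the submodule spanned by their union.\<close>

definition submodule_sum ::
  "('a, 'm) ring_scheme \<Rightarrow> ('a, 'b, 'n) module_scheme \<Rightarrow> 'b set set \<Rightarrow> 'b set" where
  "submodule_sum R M \<S> = (\<lambda>N. submodule N R M) hull (\<Union>\<S>)"

definition socle :: "('a, 'm) ring_scheme \<Rightarrow> ('a, 'b, 'n) module_scheme \<Rightarrow> 'b set" where
  "socle R M = submodule_sum R M (simple_submodules R M)"

text \<open>
  A module is semisimple if it is an internal direct sum of simple submodules. A set of
  submodules can be used instead of an indexed family, since the summands of a direct sum are
  pairwise distinct when they are nonzero.
\<close>

definition semisimple_module :: "('a, 'm) ring_scheme \<Rightarrow> ('a, 'b, 'n) module_scheme \<Rightarrow> bool" where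
  "semisimple_module R M \<longleftrightarrow>
    (\<exists>\<S> \<subseteq> simple_submodules R M.
      submodule_sum R M \<S> = carrier M \<and>
      (\<forall>S\<in>\<S>. S \<inter> submodule_sum R M (\<S> - {S}) = {\<zero>\<^bsub>M\<^esub>}))"

text \<open>Finite length means that there is a composition series.\<close>

definition finite_length :: "('a, 'm) ring_scheme \<Rightarrow> ('a, 'b, 'n) module_scheme \<Rightarrow> bool" where
  "finite_length R M \<longleftrightarrow>
    (\<exists>(n :: nat) N. N 0 = {\<zero>\<^bsub>M\<^esub>} \<and> N n = carrier M \<and>
      (\<forall>i\<le>n. submodule (N i) R M) \<and>
      (\<forall>i<n. N i \<subset> N (Suc i) \<and>
        (\<forall>K. submodule K R M \<and> N i \<subseteq> K \<and> K \<subseteq> N (Suc i) \<longrightarrow> K = N i \<or> K = N (Suc i))))"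

definition endoartinian :: "('a, 'm) ring_scheme \<Rightarrow> ('a, 'b, 'n) module_scheme \<Rightarrow> bool" where
  "endoartinian R M \<longleftrightarrow>
    (\<forall>f :: nat \<Rightarrow> 'b \<Rightarrow> 'b.
      (\<forall>i. f i \<in> module_End R M) \<and>
      (\<forall>i. f (Suc i) ` carrier M \<subseteq> f i ` carrier M) \<longrightarrow>
      (\<exists>n. \<forall>m\<ge>n. f m ` carrier M = f n ` carrier M))"

text \<open>
  Projectivity by the lifting property. HOL cannot quantify over modules of all types within a
  formula, so the carrier type \<open>'c\<close> of the test modules is a parameter; a statement with
  \<open>'c\<close> free is a statement about test modules in every type. (No generality is lost by
  giving both test modules the same type, as one can pass to a sum type.)
\<close>

definition projective_module ::
  "'c itself \<Rightarrow> ('a, 'm) ring_scheme \<Rightarrow> ('a, 'b, 'n) module_scheme \<Rightarrow> bool" where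
  "projective_module _ R P \<longleftrightarrow>
    right_module R P \<and>
    (\<forall>(A :: ('a, 'c) module) (B :: ('a, 'c) module).
      right_module R A \<and> right_module R B \<longrightarrow>
      (\<forall>g \<in> module_hom R A B. \<forall>f \<in> module_hom R P B.
        g ` carrier A = carrier B \<longrightarrow>
        (\<exists>h \<in> module_hom R P A. \<forall>x\<in>carrier P. g (h x) = f x)))"

section \<open>Rings\<close>

definition semiprime_ring :: "('a, 'm) ring_scheme \<Rightarrow> bool" where
  "semiprime_ring R \<longleftrightarrow>
    (\<forall>J. ideal J R \<longrightarrow> ideal_prod R J J = {\<zero>\<^bsub>R\<^esub>} \<longrightarrow> J = {\<zero>\<^bsub>R\<^esub>})"

definition right_endoartinian_ring :: "('a, 'm) ring_scheme \<Rightarrow> bool" where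
  "right_endoartinian_ring R \<longleftrightarrow> endoartinian R (right_regular R)"

definition semisimple_ring :: "('a, 'm) ring_scheme \<Rightarrow> bool" where
  "semisimple_ring R \<longleftrightarrow> semisimple_module R (right_regular R)"

text \<open>The right ideals of \<open>R\<close> are the submodules of the right regular module.\<close>

definition right_hereditary_ring :: "'c itself \<Rightarrow> ('a, 'm) ring_scheme \<Rightarrow> bool" where
  "right_hereditary_ring T R \<longleftrightarrow>
    (\<forall>I. submodule I R (right_regular R) \<longrightarrow>
      projective_module T R ((right_regular R)\<lparr>carrier := I\<rparr>))"

definition division_ring :: "('a, 'm) ring_scheme \<Rightarrow> bool" where
  "division_ring D \<longleftrightarrow> ring D \<and> Units D = carrier D - {\<zero>\<^bsub>D\<^esub>}"

definition matrix_ring :: "nat \<Rightarrow> ('a, 'm) ring_scheme \<Rightarrow> 'a mat ring" where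
  "matrix_ring n D =
    \<lparr>carrier = {A \<in> carrier_mat n n. elements_mat A \<subseteq> carrier D},
     monoid.mult = (\<lambda>A B. mat n n (\<lambda>(i, j). \<Oplus>\<^bsub>D\<^esub>k\<in>{..<n}. A $$ (i, k) \<otimes>\<^bsub>D\<^esub> B $$ (k, j))),
     one = mat n n (\<lambda>(i, j). if i = j then \<one>\<^bsub>D\<^esub> else \<zero>\<^bsub>D\<^esub>),
     zero = mat n n (\<lambda>_. \<zero>\<^bsub>D\<^esub>),
     add = (\<lambda>A B. mat n n (\<lambda>ij. A $$ ij \<oplus>\<^bsub>D\<^esub> B $$ ij))\<rparr>"

text \<open>
  The list holds the pairs $(n_i, D_i)$; the empty product is the zero ring. The type parameter
  is the type containing the carriers of the $D_i$. Each $D_i$ embeds additively into the matrix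
  ring product, hence into \<open>R\<close>, so up to isomorphism the carrier type of \<open>R\<close> itself suffices.
\<close>

definition product_of_matrix_rings :: "'d itself \<Rightarrow> ('a, 'm) ring_scheme \<Rightarrow> bool" where
  "product_of_matrix_rings _ R \<longleftrightarrow>
    (\<exists>Ds :: (nat \<times> 'd ring) list.
      (\<forall>(n, D)\<in>set Ds. n \<ge> 1 \<and> division_ring D) \<and>
      R \<simeq> RDirProd_list (map (\<lambda>(n, D). matrix_ring n D) Ds))"

end

theory Submission
  imports Defs
begin

text \<open>
  All conditions are compared with two finiteness statements: that $R_R$ is a sum of finitely many
  simple submodules, and that $1$ is a sum of orthogonal idempotents $e$ with $eR$ minimal. Both
  semisimplicity and $\mathrm{soc}(R_R) = R$ give the first, since $1$ already lies in a finite
  subsum. It makes every right ideal a direct summand, hence of the form $eR$ with $e$ a left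
  identity; this gives semiprimeness and projectivity of right ideals, and a composition series
  gives the chain condition. Conversely, endoartinian means the descending chain condition on
  principal right ideals, as these are the images of the endomorphisms; in a semiprime ring every
  nonzero one then contains $eR$ with $e$ a minimal idempotent, and splitting off such summands
  from $1$ terminates. Finally, for such idempotents $e_i$, the relation $e_iRe_j \neq 0$ is
  isomorphism of $e_iR$ and $e_jR$, and $r \mapsto (v_i r u_j)$, with isomorphisms $u_j$, $v_i$ to a
  representative $eR$ of each class, identifies $R$ with a product of matrix rings over the
  division rings $eRe$.
\<close>

section \<open>Sums of simple submodules\<close>

text \<open>The elementwise notion of a minimal idempotent links the two halves of the proof: it
  passes along ring isomorphisms, products and matrix units without mention of modules, and its
  corner eRe has its elements in the type of \<open>R\<close>, so that no endomorphism rings of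
  simple modules are required. Two obstacles shape the way from the semiprime and endoartinian
  condition to idempotents. Semiprimeness constrains two-sided ideals only, so a one-sided relation
  bRb = 0 must first be turned into a two-sided ideal of square zero. And an idempotent e found in
  gR satisfies ge = e but perhaps not eg = e, so it has to be corrected to eg before the remainder g
  - eg is again an idempotent orthogonal to the part split off.\<close>

context right_module
begin

section \<open>Submodules, their restriction and their binary sums\<close>

lemma smult_r_null [simp]: "a \<in> carrier R \<Longrightarrow> a \<odot>\<^bsub>M\<^esub> \<zero>\<^bsub>M\<^esub> = \<zero>\<^bsub>M\<^esub>"
  using smult_r_distr[of a "\<zero>\<^bsub>M\<^esub>" "\<zero>\<^bsub>M\<^esub>"] by (simp add: M.add.r_cancel_one')

lemma smult_l_null [simp]: "x \<in> carrier M \<Longrightarrow> \<zero>\<^bsub>R\<^esub> \<odot>\<^bsub>M\<^esub> x = \<zero>\<^bsub>M\<^esub>"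
  using smult_l_distr[of "\<zero>\<^bsub>R\<^esub>" "\<zero>\<^bsub>R\<^esub>" x] by (simp add: M.add.r_cancel_one')

lemma smult_minus_one: "x \<in> carrier M \<Longrightarrow> (\<ominus>\<^bsub>R\<^esub> \<one>\<^bsub>R\<^esub>) \<odot>\<^bsub>M\<^esub> x = \<ominus>\<^bsub>M\<^esub> x"
  using smult_l_distr[of "\<ominus>\<^bsub>R\<^esub> \<one>\<^bsub>R\<^esub>" "\<one>\<^bsub>R\<^esub>" x]
  by (simp add: R.l_neg M.minus_equality)

text \<open>The library predicate asks for an additive subgroup; negatives come for free by acting
  with \<open>\<ominus> \<one>\<close>, so closure under addition and the action suffices.\<close>

lemma submodule_iff:
  "submodule H R M \<longleftrightarrow> H \<subseteq> carrier M \<and> \<zero>\<^bsub>M\<^esub> \<in> H \<and>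
    (\<forall>x\<in>H. \<forall>y\<in>H. x \<oplus>\<^bsub>M\<^esub> y \<in> H) \<and> (\<forall>a\<in>carrier R. \<forall>x\<in>H. a \<odot>\<^bsub>M\<^esub> x \<in> H)"
  (is "_ \<longleftrightarrow> ?r")
proof
  assume "submodule H R M"
  then interpret submodule H R M .
  show ?r using subset one_closed m_closed by auto
next
  assume r: ?r
  then have "\<ominus>\<^bsub>M\<^esub> x \<in> H" if "x \<in> H" for x
    using that smult_minus_one[of x] by (metis R.add.inv_closed R.one_closed subsetD)
  with r show "submodule H R M"
    by (auto simp: submodule_def submodule_axioms_def a_inv_def[symmetric] intro!: subgroup.intro)
qed

lemma submodule_subset: "submodule H R M \<Longrightarrow> H \<subseteq> carrier M"
  by (simp add: submodule_iff)

lemma submodule_add_closed: "\<lbrakk>submodule H R M; x \<in> H; y \<in> H\<rbrakk> \<Longrightarrow> x \<oplus>\<^bsub>M\<^esub> y \<in> H"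
  by (simp add: submodule_iff)

lemma submodule_minus_closed:
  "\<lbrakk>submodule H R M; x \<in> H; y \<in> H\<rbrakk> \<Longrightarrow> x \<ominus>\<^bsub>M\<^esub> y \<in> H"
  unfolding submodule_iff a_minus_def
  by (metis R.add.inv_closed R.one_closed subsetD smult_minus_one)

lemma submodule_zero: "submodule {\<zero>\<^bsub>M\<^esub>} R M"
  by (auto simp: submodule_iff)

lemma submodule_carrier: "submodule (carrier M) R M"
  by (auto simp: submodule_iff)

lemma submodule_Int: "\<lbrakk>submodule A R M; submodule B R M\<rbrakk> \<Longrightarrow> submodule (A \<inter> B) R M"
  by (auto simp: submodule_iff)

lemma right_module_submodule:
  assumes "submodule S R M"
  shows "right_module R (M\<lparr>carrier := S\<rparr>)"
proof -
  interpret submodule S R M by fact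
  have sub: "S \<subseteq> carrier M" using subset by simp
  have "abelian_group (M\<lparr>carrier := S\<rparr>)"
  proof (rule abelian_groupI)
    fix x assume "x \<in> carrier (M\<lparr>carrier := S\<rparr>)"
    then show "\<exists>y\<in>carrier (M\<lparr>carrier := S\<rparr>). y \<oplus>\<^bsub>M\<lparr>carrier := S\<rparr>\<^esub> x = \<zero>\<^bsub>M\<lparr>carrier := S\<rparr>\<^esub>"
      using m_inv_closed[of x] sub M.l_neg by (auto simp: a_inv_def[symmetric])
  qed (use assms[unfolded submodule_iff] M.a_ac in \<open>auto simp: subset_iff\<close>)
  then show ?thesis
    using sub smult_closed
    by (auto simp: right_module_def right_module_axioms_def R.ring_axioms subset_iff
        smult_l_distr smult_r_distr smult_assoc_right)
qed

lemma submodule_restrict_iff: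
  assumes "submodule S R M"
  shows "submodule N R (M\<lparr>carrier := S\<rparr>) \<longleftrightarrow> submodule N R M \<and> N \<subseteq> S"
  using assms unfolding right_module.submodule_iff[OF right_module_submodule[OF assms]] submodule_iff
  by auto

text \<open>Expresses simplicity of the restricted record through submodules of \<open>M\<close>
  alone, so that later arguments never leave \<open>M\<close>.\<close>

lemma simple_submodules_iff:
  "S \<in> simple_submodules R M \<longleftrightarrow> submodule S R M \<and> S \<noteq> {\<zero>\<^bsub>M\<^esub>} \<and>
    (\<forall>N. submodule N R M \<and> N \<subseteq> S \<longrightarrow> N = {\<zero>\<^bsub>M\<^esub>} \<or> N = S)"
  by (auto simp: simple_submodules_def simple_module_def right_module_submodule submodule_restrict_iff)

lemma simple_Int:
  assumes "S \<in> simple_submodules R M" "submodule N R M"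
  shows "S \<inter> N = {\<zero>\<^bsub>M\<^esub>} \<or> S \<subseteq> N"
  using assms submodule_Int[of S N] unfolding simple_submodules_iff by blast

lemma submodule_set_add:
  assumes "submodule A R M" "submodule B R M"
  shows "submodule (A <+>\<^bsub>M\<^esub> B) R M"
  unfolding submodule_iff set_add_def'
proof (intro conjI ballI)
  note A = assms(1)[unfolded submodule_iff] and B = assms(2)[unfolded submodule_iff]
  show "(\<Union>h\<in>A. \<Union>k\<in>B. {h \<oplus>\<^bsub>M\<^esub> k}) \<subseteq> carrier M"
    using A B by auto
  show "\<zero>\<^bsub>M\<^esub> \<in> (\<Union>h\<in>A. \<Union>k\<in>B. {h \<oplus>\<^bsub>M\<^esub> k})"
    using A B by (auto intro!: bexI[of _ "\<zero>\<^bsub>M\<^esub>"])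
  fix x assume "x \<in> (\<Union>h\<in>A. \<Union>k\<in>B. {h \<oplus>\<^bsub>M\<^esub> k})"
  then obtain a b where x: "a \<in> A" "b \<in> B" "x = a \<oplus>\<^bsub>M\<^esub> b" by auto
  show "c \<odot>\<^bsub>M\<^esub> x \<in> (\<Union>h\<in>A. \<Union>k\<in>B. {h \<oplus>\<^bsub>M\<^esub> k})" if c: "c \<in> carrier R" for c
  proof -
    have "c \<odot>\<^bsub>M\<^esub> x = c \<odot>\<^bsub>M\<^esub> a \<oplus>\<^bsub>M\<^esub> c \<odot>\<^bsub>M\<^esub> b"
      using c x A B by (auto simp: subset_iff smult_r_distr)
    moreover have "c \<odot>\<^bsub>M\<^esub> a \<in> A" "c \<odot>\<^bsub>M\<^esub> b \<in> B"
      using c x A B by auto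
    ultimately show ?thesis by auto
  qed
  fix y assume "y \<in> (\<Union>h\<in>A. \<Union>k\<in>B. {h \<oplus>\<^bsub>M\<^esub> k})"
  then obtain a' b' where y: "a' \<in> A" "b' \<in> B" "y = a' \<oplus>\<^bsub>M\<^esub> b'" by auto
  have "x \<oplus>\<^bsub>M\<^esub> y = (a \<oplus>\<^bsub>M\<^esub> a') \<oplus>\<^bsub>M\<^esub> (b \<oplus>\<^bsub>M\<^esub> b')"
    using x y A B by (simp add: subset_iff M.a_ac)
  moreover have "a \<oplus>\<^bsub>M\<^esub> a' \<in> A" "b \<oplus>\<^bsub>M\<^esub> b' \<in> B"
    using x y A B by auto
  ultimately show "x \<oplus>\<^bsub>M\<^esub> y \<in> (\<Union>h\<in>A. \<Union>k\<in>B. {h \<oplus>\<^bsub>M\<^esub> k})"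
    by auto
qed

lemma subset_set_add:
  assumes "submodule A R M" "submodule B R M"
  shows "A \<subseteq> A <+>\<^bsub>M\<^esub> B" "B \<subseteq> A <+>\<^bsub>M\<^esub> B"
proof -
  note A = assms(1)[unfolded submodule_iff] and B = assms(2)[unfolded submodule_iff]
  show "A \<subseteq> A <+>\<^bsub>M\<^esub> B"
  proof
    fix x assume "x \<in> A"
    then have "x = x \<oplus>\<^bsub>M\<^esub> \<zero>\<^bsub>M\<^esub>" using A by (simp add: subset_iff)
    then show "x \<in> A <+>\<^bsub>M\<^esub> B" using \<open>x \<in> A\<close> B unfolding set_add_def' by blast
  qed
  show "B \<subseteq> A <+>\<^bsub>M\<^esub> B"
  proof
    fix x assume "x \<in> B"
    then have "x = \<zero>\<^bsub>M\<^esub> \<oplus>\<^bsub>M\<^esub> x" using B by (simp add: subset_iff)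
    then show "x \<in> A <+>\<^bsub>M\<^esub> B" using \<open>x \<in> B\<close> A unfolding set_add_def' by blast
  qed
qed

lemma set_add_subset:
  "\<lbrakk>submodule N R M; A \<subseteq> N; B \<subseteq> N\<rbrakk> \<Longrightarrow> A <+>\<^bsub>M\<^esub> B \<subseteq> N"
  by (auto simp: set_add_def' intro!: submodule_add_closed)

lemma modular_law:
  assumes "submodule A R M" "submodule B R M" "submodule N R M" "B \<subseteq> N" "N \<subseteq> A <+>\<^bsub>M\<^esub> B"
  shows "N = (A \<inter> N) <+>\<^bsub>M\<^esub> B"
proof
  show "N \<subseteq> (A \<inter> N) <+>\<^bsub>M\<^esub> B"
  proof
    fix x assume x: "x \<in> N"
    then obtain a b where ab: "a \<in> A" "b \<in> B" "x = a \<oplus>\<^bsub>M\<^esub> b"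
      using assms(5) by (auto simp: set_add_def')
    then have "a \<in> carrier M" "b \<in> carrier M"
      using assms by (auto simp: submodule_iff)
    then have "a = x \<ominus>\<^bsub>M\<^esub> b"
      using ab(3) by (simp add: M.minus_eq M.a_assoc M.r_neg)
    then have "a \<in> N"
      using assms x ab submodule_minus_closed[of N x b] by auto
    with ab show "x \<in> (A \<inter> N) <+>\<^bsub>M\<^esub> B" by (auto simp: set_add_def')
  qed
  show "(A \<inter> N) <+>\<^bsub>M\<^esub> B \<subseteq> N"
    using assms by (intro set_add_subset) auto
qed

section \<open>Sums of families of submodules\<close>

text \<open>The hypothesis guarantees that some submodule lies above the union. Otherwise the hull
  would be the intersection of an empty family, which is the whole type.\<close>

lemma submodule_submodule_sum:
  assumes "\<Union>\<S> \<subseteq> carrier M"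
  shows "submodule (submodule_sum R M \<S>) R M"
proof -
  have "submodule_sum R M \<S> \<subseteq> carrier M"
    using assms submodule_carrier unfolding submodule_sum_def by (intro hull_minimal)
  then show ?thesis
    unfolding submodule_iff by (auto simp: submodule_sum_def hull_def submodule_iff)
qed

lemma submodule_sum_upper: "S \<in> \<S> \<Longrightarrow> S \<subseteq> submodule_sum R M \<S>"
  unfolding submodule_sum_def by (meson Union_upper hull_subset order_trans)

lemma submodule_sum_least:
  "\<lbrakk>submodule N R M; \<And>S. S \<in> \<S> \<Longrightarrow> S \<subseteq> N\<rbrakk> \<Longrightarrow> submodule_sum R M \<S> \<subseteq> N"
  unfolding submodule_sum_def by (intro hull_minimal) auto

lemma submodule_sum_mono: "\<S> \<subseteq> \<T> \<Longrightarrow> submodule_sum R M \<S> \<subseteq> submodule_sum R M \<T>"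
  unfolding submodule_sum_def by (intro hull_mono) auto

lemma submodule_sum_empty [simp]: "submodule_sum R M {} = {\<zero>\<^bsub>M\<^esub>}"
proof
  show "submodule_sum R M {} \<subseteq> {\<zero>\<^bsub>M\<^esub>}"
    using submodule_zero by (rule submodule_sum_least) simp
  show "{\<zero>\<^bsub>M\<^esub>} \<subseteq> submodule_sum R M {}"
    using submodule_submodule_sum[of "{}"] by (simp add: submodule_iff)
qed

lemma submodule_sum_insert:
  assumes "submodule S R M" "\<And>T. T \<in> \<S> \<Longrightarrow> submodule T R M"
  shows "submodule_sum R M (insert S \<S>) = S <+>\<^bsub>M\<^esub> submodule_sum R M \<S>"
proof -
  have sub: "\<Union>\<S> \<subseteq> carrier M" "\<Union>(insert S \<S>) \<subseteq> carrier M"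
    using assms[THEN submodule_subset] by auto
  show ?thesis
  proof
    show "submodule_sum R M (insert S \<S>) \<subseteq> S <+>\<^bsub>M\<^esub> submodule_sum R M \<S>"
      using subset_set_add[OF assms(1) submodule_submodule_sum[OF sub(1)]] submodule_sum_upper[of _ \<S>]
      by (intro submodule_sum_least submodule_set_add submodule_submodule_sum assms(1) sub) auto
    show "S <+>\<^bsub>M\<^esub> submodule_sum R M \<S> \<subseteq> submodule_sum R M (insert S \<S>)"
      by (intro set_add_subset submodule_submodule_sum sub(2) submodule_sum_upper submodule_sum_mono) auto
  qed
qed

text \<open>The elements of finite subsums already form a submodule, because two finite subfamilies
  have a finite union, and the hull is the least submodule above all members.\<close>

lemma submodule_sum_finite_support:
  assumes "\<And>S. S \<in> \<S> \<Longrightarrow> submodule S R M" "x \<in> submodule_sum R M \<S>"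
  shows "\<exists>\<T>\<subseteq>\<S>. finite \<T> \<and> x \<in> submodule_sum R M \<T>"
proof -
  let ?N = "{x. \<exists>\<T>\<subseteq>\<S>. finite \<T> \<and> x \<in> submodule_sum R M \<T>}"
  have sub: "submodule (submodule_sum R M \<T>) R M" if "\<T> \<subseteq> \<S>" for \<T>
    using assms(1)[THEN submodule_subset] that by (intro submodule_submodule_sum) auto
  have "submodule ?N R M"
    unfolding submodule_iff
  proof (intro conjI ballI)
    show "?N \<subseteq> carrier M" using sub[THEN submodule_subset] by auto
    show "\<zero>\<^bsub>M\<^esub> \<in> ?N" by (auto intro!: exI[of _ "{}"])
    fix x assume "x \<in> ?N"
    then obtain \<T> where T: "\<T> \<subseteq> \<S>" "finite \<T>" "x \<in> submodule_sum R M \<T>" by auto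
    show "a \<odot>\<^bsub>M\<^esub> x \<in> ?N" if "a \<in> carrier R" for a
      using T that sub[OF T(1)] by (auto simp: submodule_iff)
    fix y assume "y \<in> ?N"
    then obtain \<U> where U: "\<U> \<subseteq> \<S>" "finite \<U>" "y \<in> submodule_sum R M \<U>" by auto
    have "x \<in> submodule_sum R M (\<T> \<union> \<U>)" "y \<in> submodule_sum R M (\<T> \<union> \<U>)"
      using T U submodule_sum_mono[of _ "\<T> \<union> \<U>"] by auto
    then show "x \<oplus>\<^bsub>M\<^esub> y \<in> ?N"
      using T(1,2) U(1,2) sub[of "\<T> \<union> \<U>"] by (auto simp: submodule_iff intro!: exI[of _ "\<T> \<union> \<U>"])
  qed
  then have "submodule_sum R M \<S> \<subseteq> ?N"
  proof (rule submodule_sum_least)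
    fix S assume "S \<in> \<S>"
    then show "S \<subseteq> ?N"
      using submodule_sum_upper[of S "{S}"] by (auto intro!: exI[of _ "{S}"])
  qed
  then show ?thesis using assms(2) by auto
qed

section \<open>Modules that are finite sums of simple submodules\<close>

lemma simple_submodulesD: "S \<in> simple_submodules R M \<Longrightarrow> submodule S R M"
  by (simp add: simple_submodules_def)

lemma submodule_sum_simple:
  "\<T> \<subseteq> simple_submodules R M \<Longrightarrow> submodule (submodule_sum R M \<T>) R M"
  by (intro submodule_submodule_sum) (auto simp: subset_iff simple_submodules_iff submodule_iff)

text \<open>A spanning subfamily of least cardinality is independent: a simple summand that meets
  the sum of the others nontrivially lies inside that sum and could be dropped.\<close>

lemma semisimple_if_finite_sum_of_simple:
  assumes "finite \<T>" "\<T> \<subseteq> simple_submodules R M" "submodule_sum R M \<T> = carrier M"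
  shows "semisimple_module R M"
proof -
  let ?P = "\<lambda>\<U>. \<U> \<subseteq> \<T> \<and> submodule_sum R M \<U> = carrier M"
  obtain \<U> where U: "?P \<U>" and min: "\<And>\<V>. ?P \<V> \<Longrightarrow> card \<U> \<le> card \<V>"
    using ex_has_least_nat[of ?P \<T> card] assms by auto
  have fin: "finite \<U>" using U assms(1) finite_subset by auto
  have "S \<inter> submodule_sum R M (\<U> - {S}) = {\<zero>\<^bsub>M\<^esub>}" if S: "S \<in> \<U>" for S
  proof (rule ccontr)
    have rest: "submodule (submodule_sum R M (\<U> - {S})) R M"
      using U assms(2) by (intro submodule_sum_simple) auto
    assume "\<not> ?thesis"
    then have "S \<subseteq> submodule_sum R M (\<U> - {S})"
      using simple_Int[OF _ rest, of S] S U assms(2) by auto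
    then have "submodule_sum R M \<U> \<subseteq> submodule_sum R M (\<U> - {S})"
      using rest submodule_sum_upper[of _ "\<U> - {S}"] by (intro submodule_sum_least) auto
    then have "submodule_sum R M (\<U> - {S}) = carrier M"
      using U rest by (auto simp: submodule_iff)
    then have "card \<U> \<le> card (\<U> - {S})"
      using U by (intro min) auto
    then show False
      using S fin by (metis card_Diff1_less leD)
  qed
  then show ?thesis
    unfolding semisimple_module_def using U assms(2) by blast
qed

text \<open>Finiteness replaces Zorn's lemma: the complement is the sum C of a largest subfamily
  whose sum meets \<open>I\<close> trivially. A simple summand outside I + C meets I + C trivially
  and could be added to the subfamily.\<close>

lemma complement_in_finite_sum_of_simple:
  assumes "finite \<T>" "\<T> \<subseteq> simple_submodules R M" "submodule_sum R M \<T> = carrier M"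
    and I: "submodule I R M"
  shows "\<exists>C. submodule C R M \<and> I \<inter> C = {\<zero>\<^bsub>M\<^esub>} \<and> I <+>\<^bsub>M\<^esub> C = carrier M"
proof -
  let ?P = "\<lambda>\<U>. \<U> \<subseteq> \<T> \<and> I \<inter> submodule_sum R M \<U> = {\<zero>\<^bsub>M\<^esub>}"
  have "?P {}" using I by (auto simp: submodule_iff)
  \<comment> \<open>The rule for a greatest element expects a strict bound, hence the
    successor.\<close>
  moreover have "\<forall>\<U>. ?P \<U> \<longrightarrow> card \<U> < Suc (card \<T>)"
    using assms(1) by (auto simp: less_Suc_eq_le intro: card_mono)
  ultimately have "\<exists>\<U>. ?P \<U> \<and> (\<forall>\<V>. ?P \<V> \<longrightarrow> card \<V> \<le> card \<U>)"
    by (rule ex_has_greatest_nat)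
  then obtain \<U> where U: "?P \<U>" and max: "\<And>\<V>. ?P \<V> \<Longrightarrow> card \<V> \<le> card \<U>"
    by (elim exE conjE) simp
  let ?C = "submodule_sum R M \<U>"
  have C: "submodule ?C R M"
    using U assms(2) by (intro submodule_sum_simple) auto
  note IC = submodule_set_add[OF I C]
  have "S \<subseteq> I <+>\<^bsub>M\<^esub> ?C" if S: "S \<in> \<T>" for S
  proof (rule ccontr)
    assume nS: "\<not> ?thesis"
    have simple: "S \<in> simple_submodules R M" using S assms(2) by auto
    have 0: "S \<inter> (I <+>\<^bsub>M\<^esub> ?C) = {\<zero>\<^bsub>M\<^esub>}"
      using simple_Int[OF simple IC] nS by auto
    have "S \<notin> \<U>"
      using nS submodule_sum_upper[of S \<U>] subset_set_add(2)[OF I C] by auto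
    have ins: "submodule_sum R M (insert S \<U>) = S <+>\<^bsub>M\<^esub> ?C"
      using U simple assms(2) by (intro submodule_sum_insert simple_submodulesD) auto
    \<comment> \<open>With x = s + c, the element s = x - c lies in S and in I + C, so it vanishes;
      then x = c lies in I and C.\<close>
    have "x = \<zero>\<^bsub>M\<^esub>" if x: "x \<in> I" "x \<in> S <+>\<^bsub>M\<^esub> ?C" for x
    proof -
      obtain s c where sc: "s \<in> S" "c \<in> ?C" "x = s \<oplus>\<^bsub>M\<^esub> c"
        using x by (auto simp: set_add_def')
      have car: "s \<in> carrier M" "c \<in> carrier M" "x \<in> carrier M"
        using sc x simple_submodulesD[OF simple] C I by (auto simp: submodule_iff)
      then have "s = x \<ominus>\<^bsub>M\<^esub> c"
        using sc(3) by (simp add: M.minus_eq M.a_assoc M.r_neg)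
      moreover have "x \<in> I <+>\<^bsub>M\<^esub> ?C" "c \<in> I <+>\<^bsub>M\<^esub> ?C"
        using x sc subset_set_add[OF I C] by auto
      ultimately have "s \<in> I <+>\<^bsub>M\<^esub> ?C"
        using submodule_minus_closed[OF IC] by auto
      then have "s = \<zero>\<^bsub>M\<^esub>" using 0 sc(1) by auto
      then have "x = c" using sc(3) car by simp
      then show ?thesis using U x(1) sc(2) by auto
    qed
    moreover have "submodule (S <+>\<^bsub>M\<^esub> ?C) R M"
      by (intro submodule_set_add C simple_submodulesD simple)
    ultimately have "I \<inter> submodule_sum R M (insert S \<U>) = {\<zero>\<^bsub>M\<^esub>}"
      unfolding ins using I by (auto simp: submodule_iff)
    then have "card (insert S \<U>) \<le> card \<U>"
      using U S by (intro max) auto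
    moreover have "finite \<U>" using U assms(1) finite_subset by auto
    ultimately show False using \<open>S \<notin> \<U>\<close> by simp
  qed
  then have "carrier M \<subseteq> I <+>\<^bsub>M\<^esub> ?C"
    using submodule_sum_least[OF IC, of \<T>] assms(3) by auto
  then show ?thesis
    using C U IC by (intro exI[of _ ?C]) (auto simp: submodule_iff)
qed

text \<open>Adding the simple summands one at a time yields a composition series, once those already
  contained in the partial sum are skipped.\<close>

lemma finite_length_if_finite_sum_of_simple:
  assumes "finite \<T>" "\<T> \<subseteq> simple_submodules R M" "submodule_sum R M \<T> = carrier M"
  shows "finite_length R M"
proof -
  let ?series = "\<lambda>n N. N 0 = {\<zero>\<^bsub>M\<^esub>} \<and> (\<forall>i\<le>n. submodule (N i) R M) \<and>
      (\<forall>i<n. N i \<subset> N (Suc i) \<and>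
        (\<forall>K. submodule K R M \<and> N i \<subseteq> K \<and> K \<subseteq> N (Suc i) \<longrightarrow> K = N i \<or> K = N (Suc i)))"
  have "\<exists>(n :: nat) N. N n = submodule_sum R M \<T> \<and> ?series n N"
    using assms(1,2)
  proof (induction \<T>)
    case empty
    then show ?case
      by (intro exI[of _ 0] exI[of _ "\<lambda>_. {\<zero>\<^bsub>M\<^esub>}"]) (simp add: submodule_zero)
  next
    case (insert S \<T>)
    then obtain n :: nat and N where N: "N n = submodule_sum R M \<T>" "?series n N" by auto
    let ?C = "submodule_sum R M \<T>"
    have simple: "S \<in> simple_submodules R M" and S: "submodule S R M"
      using insert.prems by (auto simp: simple_submodulesD)
    have C: "submodule ?C R M" using insert.prems by (intro submodule_sum_simple) auto
    have ins: "submodule_sum R M (insert S \<T>) = S <+>\<^bsub>M\<^esub> ?C"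
      using insert.prems by (intro submodule_sum_insert simple_submodulesD) auto
    show ?case
    proof (cases "S \<subseteq> ?C")
      case True
      then have "S <+>\<^bsub>M\<^esub> ?C = ?C"
        using set_add_subset[OF C True] subset_set_add(2)[OF S C] by auto
      then show ?thesis using N unfolding ins by metis
    next
      case False
      define N' where "N' i = (if i \<le> n then N i else S <+>\<^bsub>M\<^esub> ?C)" for i
      have strict: "?C \<subset> S <+>\<^bsub>M\<^esub> ?C"
        using False subset_set_add[OF S C] by auto
      \<comment> \<open>By the modular law K = (S \<inter> K) + C, and S \<inter> K is zero or
        S.\<close>
      have step: "K = ?C \<or> K = S <+>\<^bsub>M\<^esub> ?C"
        if K: "submodule K R M" "?C \<subseteq> K" "K \<subseteq> S <+>\<^bsub>M\<^esub> ?C" for K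
      proof -
        have eq: "K = (S \<inter> K) <+>\<^bsub>M\<^esub> ?C" using modular_law[OF S C] K by auto
        have "S \<inter> K = {\<zero>\<^bsub>M\<^esub>} \<or> S \<inter> K = S"
          using simple_Int[OF simple K(1)] by auto
        moreover have "{\<zero>\<^bsub>M\<^esub>} <+>\<^bsub>M\<^esub> ?C \<subseteq> ?C"
          using C by (intro set_add_subset) (auto simp: submodule_iff)
        ultimately show ?thesis using eq K(2) by auto
      qed
      have "?series (Suc n) N'"
        using N strict step submodule_set_add[OF S C]
        by (auto simp: N'_def less_Suc_eq le_Suc_eq)
      then show ?thesis unfolding ins by (intro exI[of _ "Suc n"] exI[of _ N']) (auto simp: N'_def)
    qed
  qed
  then show ?thesis unfolding finite_length_def assms(3) by metis
qed

text \<open>For nested submodules, equality can be read off the set of composition factors that they meet.\<close>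

lemma descending_chain_if_finite_length:
  assumes "finite_length R M"
    and I: "\<And>k. submodule (I k) R M" and desc: "\<And>k. I (Suc k) \<subseteq> I k"
  shows "\<exists>n :: nat. \<forall>m\<ge>n. I m = I n"
proof -
  obtain n :: nat and N where N: "N 0 = {\<zero>\<^bsub>M\<^esub>}" "N n = carrier M"
    "\<And>i. i \<le> n \<Longrightarrow> submodule (N i) R M" "\<And>i. i < n \<Longrightarrow> N i \<subset> N (Suc i)"
    "\<And>i K. \<lbrakk>i < n; submodule K R M; N i \<subseteq> K; K \<subseteq> N (Suc i)\<rbrakk> \<Longrightarrow> K = N i \<or> K = N (Suc i)"
    using assms(1) unfolding finite_length_def by metis
  define d where "d A = {i. i < n \<and> \<not> A \<inter> N (Suc i) \<subseteq> N i}" for A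
  have d_mono: "d A \<subseteq> d B" if "A \<subseteq> B" for A B
    using that unfolding d_def by auto
  have d_fin: "finite (d A)" for A unfolding d_def by auto
  have eq: "A = B" if A: "submodule A R M" and B: "submodule B R M" and sub: "A \<subseteq> B"
    and "d A = d B" for A B
  proof -
    \<comment> \<open>The larger submodule is absorbed into the smaller one layer by layer along the
      series.\<close>
    have "B \<inter> N i \<subseteq> A" if "i \<le> n" for i
      using that
    proof (induction i)
      case 0
      then show ?case using A N(1) by (auto simp: submodule_iff)
    next
      case (Suc i)
      show ?case
      proof
        fix x assume x: "x \<in> B \<inter> N (Suc i)"
        show "x \<in> A"
        proof (cases "i \<in> d B")
          case False
          then have "x \<in> N i" using x Suc.prems by (auto simp: d_def)
          then show ?thesis using Suc x by auto
        next
          case True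
          \<comment> \<open>Since A also meets this simple factor, A \<inter> N (i + 1) together
            with N i fills N (i + 1). Writing x = a + b accordingly, b = x - a lies in B because A
            \<subseteq> B, and in N i, so the induction hypothesis puts b into A.\<close>
          then have "\<not> A \<inter> N (Suc i) \<subseteq> N i" using \<open>d A = d B\<close> by (auto simp: d_def)
          moreover have Ni: "submodule (N i) R M" "submodule (N (Suc i)) R M"
            using N(3) Suc.prems by auto
          note AN = submodule_Int[OF A Ni(2)]
          have "N i \<subseteq> N (Suc i)" using N(4)[of i] Suc.prems by auto
          then have "(A \<inter> N (Suc i)) <+>\<^bsub>M\<^esub> N i = N i \<or> (A \<inter> N (Suc i)) <+>\<^bsub>M\<^esub> N i = N (Suc i)"
            using Suc.prems subset_set_add[OF AN Ni(1)] Ni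
            by (intro N(5) submodule_set_add AN set_add_subset) auto
          ultimately have "x \<in> (A \<inter> N (Suc i)) <+>\<^bsub>M\<^esub> N i"
            using x subset_set_add(1)[OF AN Ni(1)] by auto
          then obtain a b where ab: "a \<in> A" "b \<in> N i" "x = a \<oplus>\<^bsub>M\<^esub> b"
            by (auto simp: set_add_def')
          have car: "a \<in> carrier M" "b \<in> carrier M"
            using ab A Ni by (auto simp: submodule_iff)
          then have "b = x \<ominus>\<^bsub>M\<^esub> a"
            using ab(3) M.a_comm[OF car] by (simp add: M.minus_eq M.a_assoc M.r_neg)
          then have "b \<in> B"
            using submodule_minus_closed[OF B, of x a] x ab sub by auto
          then have "b \<in> A" using ab(2) Suc by auto
          then show ?thesis using ab A by (auto simp: submodule_iff)
        qed
      qed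
    qed
    from this[of n] show ?thesis using N(2) B sub by (auto simp: submodule_iff)
  qed
  have chain: "I m \<subseteq> I k" if "k \<le> m" for k m
    using that desc by (rule lift_Suc_antimono_le[rotated])
  \<comment> \<open>The number of factors met attains its minimum at k. From there on the sets of
    factors shrink without losing cardinality, so they are constant.\<close>
  obtain k where k: "\<And>m. card (d (I k)) \<le> card (d (I m))"
    using ex_has_least_nat[of "\<lambda>_. True" 0 "\<lambda>k. card (d (I k))"] by auto
  have "I m = I k" if "k \<le> m" for m
    using card_seteq[OF d_fin d_mono[OF chain[OF that]] k] by (intro eq I chain that)
  then show ?thesis by blast
qed

end

section \<open>Right ideals and minimal idempotents\<close>

lemma right_regular_simps [simp]:
  "carrier (right_regular R) = carrier R"
  "add (right_regular R) = add R"
  "zero (right_regular R) = zero R"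
  "smult (right_regular R) a x = x \<otimes>\<^bsub>R\<^esub> a"
  by (simp_all add: right_regular_def)

lemma right_regular_minus [simp]: "x \<ominus>\<^bsub>right_regular R\<^esub> y = x \<ominus>\<^bsub>R\<^esub> y"
  by (simp add: a_minus_def a_inv_def m_inv_def)

text \<open>Elementwise form of the minimality of the right ideal eR: each of its nonzero elements
  er generates e again.\<close>

definition minimal_idempotent :: "('a, 'm) ring_scheme \<Rightarrow> 'a \<Rightarrow> bool" where
  "minimal_idempotent R e \<longleftrightarrow>
    e \<in> carrier R \<and> e \<otimes>\<^bsub>R\<^esub> e = e \<and> e \<noteq> \<zero>\<^bsub>R\<^esub> \<and>
    (\<forall>r\<in>carrier R. e \<otimes>\<^bsub>R\<^esub> r \<noteq> \<zero>\<^bsub>R\<^esub> \<longrightarrow> (\<exists>s\<in>carrier R. e \<otimes>\<^bsub>R\<^esub> r \<otimes>\<^bsub>R\<^esub> s = e))"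

text \<open>Each new idempotent is required to be orthogonal to the partial sum g rather than to the
  earlier summands, so no family has to be carried around; pairwise orthogonality is recovered when
  the sum is unfolded into a set.\<close>

inductive orthogonal_idempotent_sum :: "('a, 'm) ring_scheme \<Rightarrow> 'a \<Rightarrow> bool" for R (structure) where
  zero: "orthogonal_idempotent_sum R \<zero>"
| add: "\<lbrakk>orthogonal_idempotent_sum R g; minimal_idempotent R e; e \<otimes> g = \<zero>; g \<otimes> e = \<zero>\<rbrakk> \<Longrightarrow>
    orthogonal_idempotent_sum R (g \<oplus> e)"

context ring
begin

lemmas right_regular_module = right_module_right_regular[OF ring_axioms]

lemma right_ideal_iff:
  "submodule I R (right_regular R) \<longleftrightarrow> I \<subseteq> carrier R \<and> \<zero> \<in> I \<and>
    (\<forall>x\<in>I. \<forall>y\<in>I. x \<oplus> y \<in> I) \<and> (\<forall>a\<in>carrier R. \<forall>x\<in>I. x \<otimes> a \<in> I)"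
  using right_module.submodule_iff[OF right_regular_module] by simp

lemma right_ideal_principal:
  assumes "a \<in> carrier R"
  shows "submodule (a <# carrier R) R (right_regular R)"
  unfolding right_ideal_iff l_coset_def
proof (intro conjI ballI)
  show "\<zero> \<in> (\<Union>h\<in>carrier R. {a \<otimes> h})" using assms by (auto intro!: bexI[of _ \<zero>])
next
  fix x y assume "x \<in> (\<Union>h\<in>carrier R. {a \<otimes> h})" "y \<in> (\<Union>h\<in>carrier R. {a \<otimes> h})"
  then show "x \<oplus> y \<in> (\<Union>h\<in>carrier R. {a \<otimes> h})"
    using assms by (auto simp: r_distr[symmetric])
next
  fix b x assume "b \<in> carrier R" "x \<in> (\<Union>h\<in>carrier R. {a \<otimes> h})"
  then show "x \<otimes> b \<in> (\<Union>h\<in>carrier R. {a \<otimes> h})"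
    using assms by (auto simp: m_assoc)
qed (use assms in auto)

lemma mem_principal: "x \<in> a <# carrier R \<longleftrightarrow> (\<exists>r\<in>carrier R. x = a \<otimes> r)"
  by (auto simp: l_coset_def)

lemma principal_self: "a \<in> carrier R \<Longrightarrow> a \<in> a <# carrier R"
  by (auto simp: mem_principal intro!: bexI[of _ \<one>])

lemma principal_subset: "\<lbrakk>a \<in> carrier R; b \<in> a <# carrier R\<rbrakk> \<Longrightarrow> b <# carrier R \<subseteq> a <# carrier R"
  by (auto simp: mem_principal m_assoc intro!: bexI[of _ "_ \<otimes> _"])

lemma simple_principal:
  assumes "minimal_idempotent R e"
  shows "e <# carrier R \<in> simple_submodules R (right_regular R)"
proof -
  have e: "e \<in> carrier R" "e \<noteq> \<zero>"
    and min: "\<And>r. \<lbrakk>r \<in> carrier R; e \<otimes> r \<noteq> \<zero>\<rbrakk> \<Longrightarrow> \<exists>s\<in>carrier R. e \<otimes> r \<otimes> s = e"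
    using assms by (auto simp: minimal_idempotent_def)
  have "N = {\<zero>} \<or> N = e <# carrier R"
    if N: "submodule N R (right_regular R)" "N \<subseteq> e <# carrier R" for N
  proof (cases "N = {\<zero>}")
    case False
    then obtain x where x: "x \<in> N" "x \<noteq> \<zero>" using N(1) by (auto simp: right_ideal_iff)
    then obtain r where "r \<in> carrier R" "x = e \<otimes> r" using N(2) mem_principal by blast
    then obtain s where "s \<in> carrier R" "x \<otimes> s = e" using x min by blast
    then have "e \<in> N" using N(1) x by (auto simp: right_ideal_iff)
    then have "e <# carrier R \<subseteq> N" using N(1) by (auto simp: right_ideal_iff mem_principal)
    then show ?thesis using N(2) by simp
  qed simp
  then show ?thesis
    using right_ideal_principal[OF e(1)] principal_self[OF e(1)] e(2)
    by (auto simp: right_module.simple_submodules_iff[OF right_regular_module])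
qed

lemma finite_sum_if_sum_of_simple:
  assumes "\<S> \<subseteq> simple_submodules R (right_regular R)"
    and "submodule_sum R (right_regular R) \<S> = carrier R"
  shows "\<exists>\<T>\<subseteq>\<S>. finite \<T> \<and> submodule_sum R (right_regular R) \<T> = carrier R"
proof -
  interpret reg: right_module R "right_regular R" by (rule right_regular_module)
  have "\<one> \<in> submodule_sum R (right_regular R) \<S>" using assms(2) by simp
  then obtain \<T> where T: "\<T> \<subseteq> \<S>" "finite \<T>" "\<one> \<in> submodule_sum R (right_regular R) \<T>"
    using reg.submodule_sum_finite_support[of \<S> \<one>] assms(1) reg.simple_submodulesD by blast
  have sub: "submodule (submodule_sum R (right_regular R) \<T>) R (right_regular R)"
    using T(1) assms(1) by (intro reg.submodule_sum_simple) auto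
  have "r \<in> submodule_sum R (right_regular R) \<T>" if "r \<in> carrier R" for r
    using sub[unfolded right_ideal_iff] that T(3) l_one[OF that] by metis
  then show ?thesis
    using T(1,2) sub by (auto simp: right_ideal_iff intro!: exI[of _ \<T>])
qed

text \<open>It is enough to find \<open>\<one>\<close> in the sum of all simple right ideals; the
  finite subfamily then comes from the preceding lemma instead of being tracked through the
  induction.\<close>

lemma finite_sum_if_orthogonal_idempotent_sum:
  assumes "orthogonal_idempotent_sum R \<one>"
  shows "\<exists>\<T>\<subseteq>simple_submodules R (right_regular R). finite \<T> \<and>
    submodule_sum R (right_regular R) \<T> = carrier R"
proof -
  interpret reg: right_module R "right_regular R" by (rule right_regular_module)
  let ?sum = "submodule_sum R (right_regular R) (simple_submodules R (right_regular R))"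
  have sub: "submodule ?sum R (right_regular R)"
    by (intro reg.submodule_sum_simple) auto
  have "\<one> \<in> ?sum"
    using assms
  proof induction
    case zero
    then show ?case using sub by (simp add: right_ideal_iff)
  next
    case (add g e)
    then have "e \<in> ?sum"
      using reg.submodule_sum_upper[OF simple_principal] principal_self
      by (auto simp: minimal_idempotent_def)
    with add sub show ?case by (simp add: right_ideal_iff)
  qed
  then have "r \<in> ?sum" if "r \<in> carrier R" for r
    using sub[unfolded right_ideal_iff] that l_one[OF that] by metis
  then have "?sum = carrier R" using sub by (auto simp: right_ideal_iff)
  then show ?thesis by (intro finite_sum_if_sum_of_simple) auto
qed

section \<open>The chain condition on principal right ideals and minimal idempotents\<close>

lemma left_mult_module_End: "a \<in> carrier R \<Longrightarrow> (\<lambda>x. a \<otimes> x) \<in> module_End R (right_regular R)"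
  by (auto simp: module_hom_def r_distr m_assoc)

text \<open>Well-foundedness serves twice: to choose a minimal nonzero principal right ideal, and as
  the termination order when summands are split off from \<open>\<one>\<close>.\<close>

lemma wf_principal_right_ideals:
  assumes "right_endoartinian_ring R"
  shows "wf {(a, b). a \<in> carrier R \<and> b \<in> carrier R \<and> a <# carrier R \<subset> b <# carrier R}"
  unfolding wf_iff_no_infinite_down_chain
proof
  assume "\<exists>f :: nat \<Rightarrow> 'a. \<forall>i. (f (Suc i), f i) \<in>
    {(a, b). a \<in> carrier R \<and> b \<in> carrier R \<and> a <# carrier R \<subset> b <# carrier R}"
  then obtain f :: "nat \<Rightarrow> 'a" where "\<forall>i. (f (Suc i), f i) \<in>
    {(a, b). a \<in> carrier R \<and> b \<in> carrier R \<and> a <# carrier R \<subset> b <# carrier R}" ..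
  then have f: "\<And>i. f i \<in> carrier R" "\<And>i. f (Suc i) <# carrier R \<subset> f i <# carrier R"
    by simp_all
  have image: "(\<lambda>x. a \<otimes> x) ` carrier R = a <# carrier R" for a
    by (auto simp: mem_principal)
  have "\<exists>n. \<forall>m\<ge>n. (\<lambda>x. f m \<otimes> x) ` carrier R = (\<lambda>x. f n \<otimes> x) ` carrier R"
    using assms[unfolded right_endoartinian_ring_def endoartinian_def, rule_format, of "\<lambda>i x. f i \<otimes> x"]
      left_mult_module_End f unfolding right_regular_simps image by blast
  then obtain n where "f (Suc n) <# carrier R = f n <# carrier R"
    unfolding image by (meson le_SucI order_refl)
  with f(2)[of n] show False by simp
qed

text \<open>Brauer's lemma: as $bRb \neq 0$, left multiplication by some $x \in bR$ is injective on
  $bR$ with $xbR = bR$, and the solution $e \in bR$ of $xe = x$ is the idempotent.\<close>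

lemma minimal_idempotent_in_minimal_right_ideal:
  assumes "semiprime_ring R" and b: "b \<in> carrier R" "b \<noteq> \<zero>"
    and min: "\<And>c. \<lbrakk>c \<in> b <# carrier R; c \<noteq> \<zero>\<rbrakk> \<Longrightarrow> b \<in> c <# carrier R"
  shows "\<exists>e \<in> b <# carrier R. minimal_idempotent R e"
proof -
  have "\<exists>r\<in>carrier R. b \<otimes> r \<otimes> b \<noteq> \<zero>"
  proof (rule ccontr)
    assume "\<not> ?thesis"
    then have b0: "\<And>r. r \<in> carrier R \<Longrightarrow> b \<otimes> r \<otimes> b = \<zero>" by auto
    \<comment> \<open>K is the right annihilator of bR, and J consists of those x in K with xRK = 0.
      Both are two-sided, J \<subseteq> K forces the square of J to vanish, and bRb = 0 puts b first
      into K and then into J. This contradicts semiprimeness without computing in the ideal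
      generated by b, whose elements are sums.\<close>
    define K where "K = {x \<in> carrier R. \<forall>r\<in>carrier R. b \<otimes> r \<otimes> x = \<zero>}"
    define J where "J = {x \<in> K. \<forall>y\<in>K. \<forall>r\<in>carrier R. x \<otimes> r \<otimes> y = \<zero>}"
    have K: "ideal K R"
    proof (rule idealI)
      show "subgroup K (add_monoid R)"
        by (rule add.subgroupI) (auto simp: K_def b r_distr r_minus simp flip: a_inv_def
            intro!: exI[of _ \<zero>])
      show "x \<otimes> a \<in> K" if "a \<in> K" "x \<in> carrier R" for a x
      proof -
        have "b \<otimes> r \<otimes> (x \<otimes> a) = b \<otimes> (r \<otimes> x) \<otimes> a" if "r \<in> carrier R" for r
          using that \<open>a \<in> K\<close> \<open>x \<in> carrier R\<close> b by (simp add: K_def m_assoc)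
        then show ?thesis using that by (simp add: K_def)
      qed
      show "a \<otimes> x \<in> K" if "a \<in> K" "x \<in> carrier R" for a x
        using that b by (simp add: K_def m_assoc[symmetric])
    qed (rule ring_axioms)
    have Kc: "\<And>x. x \<in> K \<Longrightarrow> x \<in> carrier R" by (simp add: K_def)
    have J: "ideal J R"
    proof (rule idealI)
      show "subgroup J (add_monoid R)"
      proof (rule add.subgroupI)
        show "J \<noteq> {}" using K Kc by (auto simp: J_def additive_subgroup.zero_closed ideal.axioms(1) intro!: exI[of _ \<zero>])
      qed (auto simp: J_def Kc l_distr l_minus K additive_subgroup.a_closed additive_subgroup.a_inv_closed ideal.axioms(1)
            simp flip: a_inv_def)
      show "x \<otimes> a \<in> J" if "a \<in> J" "x \<in> carrier R" for a x
        using that ideal.I_l_closed[OF K] by (auto simp: J_def Kc m_assoc)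
      show "a \<otimes> x \<in> J" if "a \<in> J" "x \<in> carrier R" for a x
      proof -
        have "a \<otimes> x \<otimes> r \<otimes> y = a \<otimes> (x \<otimes> r) \<otimes> y" if "r \<in> carrier R" "y \<in> K" for r y
          using that \<open>a \<in> J\<close> \<open>x \<in> carrier R\<close> by (simp add: J_def Kc m_assoc)
        then show ?thesis using that ideal.I_r_closed[OF K] by (simp add: J_def)
      qed
    qed (rule ring_axioms)
    have "x \<in> {\<zero>}" if "x \<in> ideal_prod R J J" for x
      using that
    proof induction
      case (prod i j)
      then have "i \<otimes> \<one> \<otimes> j = \<zero>" unfolding J_def mem_Collect_eq using one_closed by metis
      then show ?case using prod by (simp add: J_def Kc)
    qed simp
    moreover have "\<zero> \<in> ideal_prod R J J"
      using additive_subgroup.zero_closed[OF ideal.axioms(1)[OF ideal_prod_is_ideal[OF J J]]] .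
    ultimately have "ideal_prod R J J = {\<zero>}" by blast
    then have "J = {\<zero>}" using assms(1) J by (auto simp: semiprime_ring_def)
    moreover have "b \<in> J" using b b0 by (auto simp: J_def K_def)
    ultimately show False using b(2) by auto
  qed
  then obtain r where r: "r \<in> carrier R" "b \<otimes> r \<otimes> b \<noteq> \<zero>" by auto
  define x where "x = b \<otimes> r"
  have x: "x \<in> carrier R" "x \<in> b <# carrier R" "x \<otimes> b \<noteq> \<zero>"
    using r b by (auto simp: x_def mem_principal)
  \<comment> \<open>A nonzero y in bR generates b, so xy = 0 would give xb = 0.\<close>
  have inj: "y = \<zero>" if y: "y \<in> b <# carrier R" "x \<otimes> y = \<zero>" for y
  proof (rule ccontr)
    assume "y \<noteq> \<zero>"
    then obtain s where "s \<in> carrier R" "b = y \<otimes> s" using min[OF y(1)] by (auto simp: mem_principal)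
    moreover have "y \<in> carrier R" using y(1) b by (auto simp: mem_principal)
    ultimately have "x \<otimes> b = \<zero>" using y(2) x(1) by (simp add: m_assoc[symmetric])
    then show False using x(3) by simp
  qed
  have "x \<otimes> b \<in> b <# carrier R" using b r by (auto simp: x_def mem_principal m_assoc)
  then have "b \<in> (x \<otimes> b) <# carrier R" using min x(3) by auto
  then obtain s where s: "s \<in> carrier R" "b = x \<otimes> b \<otimes> s" by (auto simp: mem_principal)
  \<comment> \<open>From b = xbs it follows that x = br = x(bsr), which dictates this
    choice.\<close>
  define e where "e = b \<otimes> s \<otimes> r"
  have e: "e \<in> carrier R" "e \<in> b <# carrier R"
    using b s r by (auto simp: e_def mem_principal m_assoc)
  have xe: "x \<otimes> e = x"
  proof -
    have "x \<otimes> e = x \<otimes> b \<otimes> s \<otimes> r" using x(1) b(1) s(1) r(1) by (simp add: e_def m_assoc)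
    also have "\<dots> = b \<otimes> r" by (simp only: s(2)[symmetric])
    also have "\<dots> = x" by (simp add: x_def)
    finally show ?thesis .
  qed
  \<comment> \<open>Left multiplication by x sends both ee and e to x, and it is injective on
    bR.\<close>
  have "x \<otimes> (e \<otimes> e \<ominus> e) = \<zero>"
    using e x xe by (simp add: minus_eq r_distr r_minus m_assoc[symmetric] r_neg)
  moreover have "e \<otimes> e \<ominus> e \<in> b <# carrier R"
  proof -
    obtain t where "t \<in> carrier R" "e = b \<otimes> t" using e(2) by (auto simp: mem_principal)
    then have "e \<otimes> e \<ominus> e = b \<otimes> (t \<otimes> e \<ominus> t)"
      using e(1) b by (simp add: minus_eq r_distr r_minus m_assoc)
    then show ?thesis using \<open>t \<in> carrier R\<close> e(1) by (auto simp: mem_principal)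
  qed
  ultimately have "e \<otimes> e \<ominus> e = \<zero>" using inj by auto
  then have ee: "e \<otimes> e = e"
    using e(1) minus_equality[of "e \<otimes> e" "\<ominus> e"] by (simp add: minus_eq)
  have "e \<noteq> \<zero>" using xe x b by auto
  moreover have "\<exists>s\<in>carrier R. e \<otimes> t \<otimes> s = e" if t: "t \<in> carrier R" "e \<otimes> t \<noteq> \<zero>" for t
  proof -
    have "e \<otimes> t \<in> b <# carrier R" using e b t(1) by (auto simp: mem_principal m_assoc)
    then have "b \<in> (e \<otimes> t) <# carrier R" using min t(2) by auto
    then have "e \<in> (e \<otimes> t) <# carrier R"
      using principal_subset[of "e \<otimes> t" b] e t by auto
    then show ?thesis unfolding mem_principal by metis
  qed
  ultimately show ?thesis using e ee by (auto simp: minimal_idempotent_def)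
qed

text \<open>Minimality among principal right ideals is enough, because the preceding lemma tests b
  only against right ideals generated by a single element.\<close>

lemma minimal_idempotent_in_principal:
  assumes "semiprime_ring R" "right_endoartinian_ring R" and a: "a \<in> carrier R" "a \<noteq> \<zero>"
  shows "\<exists>e \<in> a <# carrier R. minimal_idempotent R e"
proof -
  have carr: "b \<in> carrier R" if "b \<in> a <# carrier R" for b
    using that a(1) by (auto simp: mem_principal)
  have "a \<in> {b \<in> a <# carrier R. b \<noteq> \<zero>}" using a principal_self by auto
  then obtain b where b: "b \<in> {b \<in> a <# carrier R. b \<noteq> \<zero>}"
    and min: "\<And>c. (c, b) \<in> {(a, b). a \<in> carrier R \<and> b \<in> carrier R \<and> a <# carrier R \<subset> b <# carrier R} \<Longrightarrow>
      c \<notin> {b \<in> a <# carrier R. b \<noteq> \<zero>}"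
    by (rule wfE_min[OF wf_principal_right_ideals[OF assms(2)]]) blast
  then have b: "b \<in> a <# carrier R" "b \<noteq> \<zero>" by auto
  have bc: "b \<in> carrier R" using b carr by auto
  have "b \<in> c <# carrier R" if c: "c \<in> b <# carrier R" "c \<noteq> \<zero>" for c
  proof (rule ccontr)
    assume "b \<notin> c <# carrier R"
    then have "c <# carrier R \<subset> b <# carrier R"
      using principal_subset[OF bc c(1)] principal_self[OF bc] by auto
    moreover have "c \<in> carrier R" using c(1) bc by (auto simp: mem_principal)
    moreover have "c \<in> a <# carrier R" using c(1) principal_subset[OF a(1) b(1)] by auto
    ultimately show False using min[of c] bc c(2) by simp
  qed
  then obtain e where "e \<in> b <# carrier R" "minimal_idempotent R e"
    using minimal_idempotent_in_minimal_right_ideal[OF assms(1) bc b(2)] by auto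
  then show ?thesis using principal_subset[OF a(1) b(1)] by auto
qed

lemma orthogonal_idempotent_sum_one:
  assumes "semiprime_ring R" "right_endoartinian_ring R"
  shows "orthogonal_idempotent_sum R \<one>"
proof -
  \<comment> \<open>The induction covers all idempotents g, ordered by gR, because the remainder
    left by each splitting is the next one to be treated.\<close>
  have "orthogonal_idempotent_sum R g" if "g \<in> carrier R" "g \<otimes> g = g" for g
    using wf_principal_right_ideals[OF assms(2)] that
  proof (induction g rule: wf_induct_rule)
    case (less g)
    show ?case
    proof (cases "g = \<zero>")
      case False
      then obtain e where e: "e \<in> g <# carrier R" "minimal_idempotent R e"
        using minimal_idempotent_in_principal[OF assms] less.prems by auto
      then have ec: "e \<in> carrier R" "e \<otimes> e = e" "e \<noteq> \<zero>"
        and min: "\<And>r. \<lbrakk>r \<in> carrier R; e \<otimes> r \<noteq> \<zero>\<rbrakk> \<Longrightarrow> \<exists>s\<in>carrier R. e \<otimes> r \<otimes> s = e"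
        by (auto simp: minimal_idempotent_def)
      note g = less.prems
      have ge: "g \<otimes> e = e"
        using e(1) g by (auto simp: mem_principal m_assoc[symmetric])
      \<comment> \<open>As fe = e, this generates the same right ideal as e, but it is absorbed by g
        on both sides.\<close>
      define f where "f = e \<otimes> g"
      have f: "f \<in> carrier R" "g \<otimes> f = f" "f \<otimes> g = f" "f \<otimes> e = e"
        using ec g ge by (simp_all add: f_def m_assoc) (simp add: m_assoc[symmetric])
      have ff: "f \<otimes> f = f"
        using f ec g by (simp add: f_def m_assoc[symmetric])
      have f0: "f \<noteq> \<zero>" using f(4) ec by auto
      have min_f: "minimal_idempotent R f"
        unfolding minimal_idempotent_def
      proof (intro conjI ballI impI f(1) ff f0)
        fix r assume r: "r \<in> carrier R" "f \<otimes> r \<noteq> \<zero>"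
        then have "e \<otimes> (g \<otimes> r) \<noteq> \<zero>" using ec g by (simp add: f_def m_assoc)
        then obtain s where s: "s \<in> carrier R" "e \<otimes> (g \<otimes> r) \<otimes> s = e" using min r g by auto
        then have "f \<otimes> r \<otimes> (s \<otimes> g) = f"
          using ec g r by (simp add: f_def m_assoc[symmetric])
        then show "\<exists>s\<in>carrier R. f \<otimes> r \<otimes> s = f" using s g by blast
      qed
      define h where "h = g \<ominus> f"
      have h: "h \<in> carrier R" "h \<otimes> f = \<zero>" "f \<otimes> h = \<zero>" "g \<otimes> h = h" "h \<otimes> g = h"
        using f ff g by (simp_all add: h_def minus_eq l_distr r_distr l_minus r_minus r_neg)
      have "h \<otimes> h = h"
      proof -
        have "h \<otimes> h = h \<otimes> g \<ominus> h \<otimes> f" using h(1) f g by (subst (2) h_def) (simp add: minus_eq r_distr r_minus)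
        then show ?thesis using h by (simp add: minus_eq)
      qed
      moreover have "h <# carrier R \<subset> g <# carrier R"
      proof
        show "h <# carrier R \<subseteq> g <# carrier R"
          using h g by (intro principal_subset) (auto simp: mem_principal intro!: bexI[of _ h])
        \<comment> \<open>The descent is strict because hR is annihilated by f from the left,
          whereas ff = f is nonzero.\<close>
        have "f \<notin> h <# carrier R"
        proof
          assume "f \<in> h <# carrier R"
          then obtain x where "x \<in> carrier R" "f = h \<otimes> x" by (auto simp: mem_principal)
          then have "f \<otimes> f = \<zero>" using f h by (metis m_assoc l_null)
          then show False using ff f0 by simp
        qed
        moreover have "f \<in> g <# carrier R" using f by (auto simp: mem_principal intro!: bexI[of _ f])
        ultimately show "h <# carrier R \<noteq> g <# carrier R" by auto
      qed
      ultimately have "orthogonal_idempotent_sum R h"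
        using less.IH h(1) g by auto
      then have "orthogonal_idempotent_sum R (h \<oplus> f)"
        using min_f h by (intro orthogonal_idempotent_sum.add)
      moreover have "h \<oplus> f = g"
        using f g by (simp add: h_def minus_eq a_assoc l_neg)
      ultimately show ?thesis by simp
    qed (simp add: orthogonal_idempotent_sum.zero)
  qed
  then show ?thesis by auto
qed

section \<open>Left identities of right ideals and their consequences\<close>

text \<open>Decompose \<open>\<one>\<close> as e + c along a complement C of \<open>I\<close>. For x
  in \<open>I\<close>, the element cx = x - ex lies in both \<open>I\<close> and C, hence
  vanishes.\<close>

lemma idempotent_generator:
  assumes "finite \<T>" "\<T> \<subseteq> simple_submodules R (right_regular R)"
    and "submodule_sum R (right_regular R) \<T> = carrier R"
    and I: "submodule I R (right_regular R)"
  shows "\<exists>e\<in>I. \<forall>x\<in>I. e \<otimes> x = x"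
proof -
  interpret reg: right_module R "right_regular R" by (rule right_regular_module)
  obtain C where C: "submodule C R (right_regular R)" "I \<inter> C = {\<zero>}"
    "I <+>\<^bsub>right_regular R\<^esub> C = carrier R"
    using reg.complement_in_finite_sum_of_simple[OF assms(1,2) _ I] assms(3) by auto
  have "\<one> \<in> I <+>\<^bsub>right_regular R\<^esub> C" using C(3) by simp
  then obtain e c where ec: "e \<in> I" "c \<in> C" "\<one> = e \<oplus> c"
    by (auto simp: set_add_def')
  then have car: "e \<in> carrier R" "c \<in> carrier R"
    using I C(1) by (auto simp: right_ideal_iff)
  have "e \<otimes> x = x" if x: "x \<in> I" for x
  proof -
    have xc: "x \<in> carrier R" using x I by (auto simp: right_ideal_iff)
    have sum: "x = e \<otimes> x \<oplus> c \<otimes> x"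
      using l_distr[OF car xc] ec(3)[symmetric] xc by simp
    then have "c \<otimes> x = x \<ominus> e \<otimes> x"
      using car xc a_comm[of "e \<otimes> x" "c \<otimes> x"]
      by (metis add.inv_solve_right m_closed minus_eq)
    moreover have "e \<otimes> x \<in> I" using ec I xc by (auto simp: right_ideal_iff)
    ultimately have "c \<otimes> x \<in> I" using reg.submodule_minus_closed[OF I x, of "e \<otimes> x"]
      by simp
    moreover have "c \<otimes> x \<in> C" using ec C(1) xc by (auto simp: right_ideal_iff)
    ultimately have "c \<otimes> x = \<zero>" using C(2) by auto
    then show ?thesis using sum car xc by simp
  qed
  then show ?thesis using ec(1) by auto
qed

text \<open>A two-sided ideal J, read as a right ideal, contains a left identity e of itself, so
  each x = ex already is a product of two elements of J.\<close>

lemma semiprime_if_finite_sum_of_simple: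
  assumes "finite \<T>" "\<T> \<subseteq> simple_submodules R (right_regular R)"
    and "submodule_sum R (right_regular R) \<T> = carrier R"
  shows "semiprime_ring R"
  unfolding semiprime_ring_def
proof (intro allI impI)
  fix J assume J: "ideal J R" and JJ: "ideal_prod R J J = {\<zero>}"
  interpret J: ideal J R by (rule J)
  have "submodule J R (right_regular R)"
    unfolding right_ideal_iff using J.Icarr J.I_r_closed by auto
  then obtain e where e: "e \<in> J" "\<And>x. x \<in> J \<Longrightarrow> e \<otimes> x = x"
    using idempotent_generator[OF assms] by blast
  have "e \<otimes> x = \<zero>" if "x \<in> J" for x
    using ideal_prod.prod[OF e(1) that, of R] JJ by auto
  then show "J = {\<zero>}" using e by auto
qed

lemma endoartinian_if_finite_sum_of_simple:
  assumes "finite \<T>" "\<T> \<subseteq> simple_submodules R (right_regular R)"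
    and "submodule_sum R (right_regular R) \<T> = carrier R"
  shows "right_endoartinian_ring R"
  unfolding right_endoartinian_ring_def endoartinian_def
proof (intro allI impI)
  interpret reg: right_module R "right_regular R" by (rule right_regular_module)
  fix f :: "nat \<Rightarrow> 'a \<Rightarrow> 'a"
  assume f: "(\<forall>i. f i \<in> module_End R (right_regular R)) \<and>
    (\<forall>i. f (Suc i) ` carrier (right_regular R) \<subseteq> f i ` carrier (right_regular R))"
  have "submodule (f i ` carrier R) R (right_regular R)" for i
  proof -
    have fi: "\<And>x. x \<in> carrier R \<Longrightarrow> f i x \<in> carrier R"
      "\<And>x y. \<lbrakk>x \<in> carrier R; y \<in> carrier R\<rbrakk> \<Longrightarrow> f i (x \<oplus> y) = f i x \<oplus> f i y"
      "\<And>x a. \<lbrakk>x \<in> carrier R; a \<in> carrier R\<rbrakk> \<Longrightarrow> f i (x \<otimes> a) = f i x \<otimes> a"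
      using f by (auto simp: module_hom_def)
    have "f i \<zero> = \<zero>" using fi(3)[of \<zero> \<zero>] fi(1)[of \<zero>] by simp
    then have "\<zero> \<in> f i ` carrier R" by (metis image_eqI zero_closed)
    then show ?thesis
      unfolding right_ideal_iff by (auto simp: fi simp flip: fi(2,3))
  qed
  then show "\<exists>n. \<forall>m\<ge>n. f m ` carrier (right_regular R) = f n ` carrier (right_regular R)"
    using f assms
    by (intro reg.descending_chain_if_finite_length reg.finite_length_if_finite_sum_of_simple[of \<T>]) auto
qed

text \<open>With a left identity e of \<open>I\<close>, a homomorphism is determined by its value at
  e, since f(x) = f(ex) = f(e)x. Lifting the single element f(e) therefore lifts f.\<close>

lemma hereditary_if_finite_sum_of_simple:
  assumes "finite \<T>" "\<T> \<subseteq> simple_submodules R (right_regular R)"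
    and "submodule_sum R (right_regular R) \<T> = carrier R"
  shows "right_hereditary_ring TYPE('c) R"
  unfolding right_hereditary_ring_def projective_module_def
proof (intro allI impI conjI ballI)
  interpret reg: right_module R "right_regular R" by (rule right_regular_module)
  fix I assume I: "submodule I R (right_regular R)"
  let ?I = "(right_regular R)\<lparr>carrier := I\<rparr>"
  show "right_module R ?I" by (rule reg.right_module_submodule[OF I])
  fix A B :: "('a, 'c) module" and g f
  assume AB: "right_module R A \<and> right_module R B" and g: "g \<in> module_hom R A B"
    and f: "f \<in> module_hom R ?I B" and surj: "g ` carrier A = carrier B"
  interpret A: right_module R A using AB by simp
  obtain e where e: "e \<in> I" "\<And>x. x \<in> I \<Longrightarrow> e \<otimes> x = x"
    using idempotent_generator[OF assms I] by auto
  have Ic: "\<And>x. x \<in> I \<Longrightarrow> x \<in> carrier R" using I by (auto simp: right_ideal_iff)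
  have "f e \<in> carrier B" using f e(1) by (auto simp: module_hom_def)
  then obtain a where a: "a \<in> carrier A" "g a = f e" using surj by (metis imageE)
  let ?h = "\<lambda>x. x \<odot>\<^bsub>A\<^esub> a"
  have "?h \<in> module_hom R ?I A"
    using a(1) by (auto simp: module_hom_def Ic A.smult_l_distr A.smult_assoc_right)
  moreover have "g (?h x) = f x" if x: "x \<in> I" for x
  proof -
    have "g (?h x) = x \<odot>\<^bsub>B\<^esub> f e" using g a x by (auto simp: module_hom_def Ic)
    also have "\<dots> = f (e \<otimes> x)" using f x e(1) by (auto simp: module_hom_def Ic)
    finally show ?thesis using e(2) x by simp
  qed
  ultimately show "\<exists>h\<in>module_hom R ?I A. \<forall>x\<in>carrier ?I. g (h x) = f x"
    by (intro bexI[of _ ?h]) simp_all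
qed

section \<open>Module-theoretic characterizations of semisimple rings\<close>

lemma semisimple_iff_finite_sum_of_simple:
  "semisimple_ring R \<longleftrightarrow> (\<exists>\<T>\<subseteq>simple_submodules R (right_regular R). finite \<T> \<and>
    submodule_sum R (right_regular R) \<T> = carrier R)"
proof
  assume "semisimple_ring R"
  then obtain \<S> where "\<S> \<subseteq> simple_submodules R (right_regular R)"
    "submodule_sum R (right_regular R) \<S> = carrier R"
    unfolding semisimple_ring_def semisimple_module_def by auto
  then show "\<exists>\<T>\<subseteq>simple_submodules R (right_regular R). finite \<T> \<and>
      submodule_sum R (right_regular R) \<T> = carrier R"
    using finite_sum_if_sum_of_simple by (meson order_trans)
next
  interpret reg: right_module R "right_regular R" by (rule right_regular_module)
  assume "\<exists>\<T>\<subseteq>simple_submodules R (right_regular R). finite \<T> \<and>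
    submodule_sum R (right_regular R) \<T> = carrier R"
  then show "semisimple_ring R"
    unfolding semisimple_ring_def using reg.semisimple_if_finite_sum_of_simple by auto
qed

text \<open>The passage from simple summands to idempotents is indirect: a finite sum gives
  semiprimeness and the chain condition, and these split \<open>\<one>\<close>. This replaces a
  direct decomposition of \<open>\<one>\<close> along the summands.\<close>

lemma semisimple_iff_orthogonal_idempotent_sum:
  "semisimple_ring R \<longleftrightarrow> orthogonal_idempotent_sum R \<one>"
  using semisimple_iff_finite_sum_of_simple finite_sum_if_orthogonal_idempotent_sum
    orthogonal_idempotent_sum_one semiprime_if_finite_sum_of_simple endoartinian_if_finite_sum_of_simple
  by meson

lemma semisimple_iff_semiprime_endoartinian:
  "semisimple_ring R \<longleftrightarrow> semiprime_ring R \<and> right_endoartinian_ring R"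
  using semisimple_iff_finite_sum_of_simple semisimple_iff_orthogonal_idempotent_sum
    orthogonal_idempotent_sum_one semiprime_if_finite_sum_of_simple endoartinian_if_finite_sum_of_simple
  by meson

lemma semisimple_iff_hereditary_socle_finite_length:
  "semisimple_ring R \<longleftrightarrow> right_hereditary_ring TYPE('c) R \<and>
    socle R (right_regular R) = carrier R \<and> finite_length R (right_regular R)"
proof
  interpret reg: right_module R "right_regular R" by (rule right_regular_module)
  assume "semisimple_ring R"
  then obtain \<T> where T: "finite \<T>" "\<T> \<subseteq> simple_submodules R (right_regular R)"
    "submodule_sum R (right_regular R) \<T> = carrier R"
    using semisimple_iff_finite_sum_of_simple by auto
  have "carrier R \<subseteq> socle R (right_regular R)"
    unfolding socle_def using reg.submodule_sum_mono[OF T(2)] T(3) by simp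
  moreover have "socle R (right_regular R) \<subseteq> carrier R"
    unfolding socle_def using reg.submodule_subset[OF reg.submodule_sum_simple] by auto
  ultimately show "right_hereditary_ring TYPE('c) R \<and>
      socle R (right_regular R) = carrier R \<and> finite_length R (right_regular R)"
    using hereditary_if_finite_sum_of_simple[OF T] reg.finite_length_if_finite_sum_of_simple[OF T(1,2)] T(3)
    by auto
next
  assume "right_hereditary_ring TYPE('c) R \<and>
    socle R (right_regular R) = carrier R \<and> finite_length R (right_regular R)"
  then show "semisimple_ring R"
    unfolding semisimple_iff_finite_sum_of_simple
    using finite_sum_if_sum_of_simple[of "simple_submodules R (right_regular R)"]
    by (auto simp: socle_def)
qed

end

section \<open>Matrix rings and finite products\<close>

text \<open>Unlike the library congruence rules, this one needs no typing assumption, so the simplifier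
  can use it.\<close>

lemma finsum_cong_simp:
  assumes "A = B" "\<And>i. i \<in> B =simp=> f i = g i"
  shows "finsum G f A = finsum G g B"
proof -
  \<comment> \<open>The sum is a definite description over \<open>foldSetD\<close>, so it suffices
    that this relation sees a function only through its values on the index set, whether or not they
    lie in the carrier.\<close>
  have "(C, y) \<in> foldSetD (carrier G) (add G \<circ> f') \<zero>\<^bsub>G\<^esub>"
    if "(C, y) \<in> foldSetD (carrier G) (add G \<circ> g') \<zero>\<^bsub>G\<^esub>" "\<forall>i\<in>C. f' i = g' i" for C y f' g'
    using that
  proof (induction rule: foldSetD.induct)
    case emptyI
    then show ?case by (simp add: foldSetD.emptyI)
  next
    case (insertI x C y)
    then show ?case
      using foldSetD.insertI[of x C "add G \<circ> f'" y "carrier G"] by (simp add: comp_def)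
  qed
  from this[of B _ f g] this[of B _ g f] have
    "(B, y) \<in> foldSetD (carrier G) (add G \<circ> f) \<zero>\<^bsub>G\<^esub> \<longleftrightarrow> (B, y) \<in> foldSetD (carrier G) (add G \<circ> g) \<zero>\<^bsub>G\<^esub>"
    for y using assms(2) by (auto simp: simp_implies_def)
  then show ?thesis
    by (simp add: assms(1) finsum_def finprod_def foldD_def)
qed

lemma (in abelian_monoid) finsum_swap:
  assumes "finite A" "finite B" "\<And>i j. \<lbrakk>i \<in> A; j \<in> B\<rbrakk> \<Longrightarrow> f i j \<in> carrier G"
  shows "(\<Oplus>i\<in>A. \<Oplus>j\<in>B. f i j) = (\<Oplus>j\<in>B. \<Oplus>i\<in>A. f i j)"
  using assms(1,3)
proof (induction A)
  case empty
  then show ?case by simp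
next
  case (insert x A)
  then have "(\<Oplus>j\<in>B. \<Oplus>i\<in>insert x A. f i j) = (\<Oplus>j\<in>B. f x j \<oplus> (\<Oplus>i\<in>A. f i j))"
    by (intro finsum_cong') (auto intro!: finsum_closed)
  also have "\<dots> = (\<Oplus>j\<in>B. f x j) \<oplus> (\<Oplus>j\<in>B. \<Oplus>i\<in>A. f i j)"
    using insert.prems by (intro finsum_addf) (auto intro!: finsum_closed)
  finally show ?case
    using insert by (auto intro!: finsum_insert finsum_closed)
qed

lemma (in abelian_monoid) finsum_single:
  assumes "finite A" "i \<in> A" "f i \<in> carrier G" "\<And>j. \<lbrakk>j \<in> A; j \<noteq> i\<rbrakk> \<Longrightarrow> f j = \<zero>"
  shows "finsum G f A = f i"
proof -
  have "finsum G f A = (\<Oplus>j\<in>A. if i = j then f i else \<zero>)"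
    using assms by (intro finsum_cong') auto
  also have "\<dots> = f i"
    using finsum_singleton[of i A "\<lambda>_. f i"] assms by auto
  finally show ?thesis .
qed

section \<open>Matrix rings and their diagonal idempotents\<close>

lemma matrix_ring_carrier:
  "A \<in> carrier (matrix_ring n D) \<longleftrightarrow>
    A \<in> carrier_mat n n \<and> (\<forall>i<n. \<forall>j<n. A $$ (i, j) \<in> carrier D)"
  by (fastforce simp: matrix_ring_def)

lemma matrix_ring_simps:
  "A \<otimes>\<^bsub>matrix_ring n D\<^esub> B =
    mat n n (\<lambda>(i, j). \<Oplus>\<^bsub>D\<^esub>k\<in>{..<n}. A $$ (i, k) \<otimes>\<^bsub>D\<^esub> B $$ (k, j))"
  "\<one>\<^bsub>matrix_ring n D\<^esub> = mat n n (\<lambda>(i, j). if i = j then \<one>\<^bsub>D\<^esub> else \<zero>\<^bsub>D\<^esub>)"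
  "\<zero>\<^bsub>matrix_ring n D\<^esub> = mat n n (\<lambda>_. \<zero>\<^bsub>D\<^esub>)"
  "A \<oplus>\<^bsub>matrix_ring n D\<^esub> B = mat n n (\<lambda>ij. A $$ ij \<oplus>\<^bsub>D\<^esub> B $$ ij)"
  by (simp_all add: matrix_ring_def)

definition elementary_mat :: "('a, 'm) ring_scheme \<Rightarrow> nat \<Rightarrow> nat \<Rightarrow> nat \<Rightarrow> 'a \<Rightarrow> 'a mat" where
  "elementary_mat D n i j d = mat n n (\<lambda>(a, b). if a = i \<and> b = j then d else \<zero>\<^bsub>D\<^esub>)"

context ring
begin

lemma ring_matrix_ring: "ring (matrix_ring n R)"
proof (rule ringI)
  show "abelian_group (matrix_ring n R)"
  proof (rule abelian_groupI)
    fix A assume "A \<in> carrier (matrix_ring n R)"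
    then show "\<exists>B\<in>carrier (matrix_ring n R). B \<oplus>\<^bsub>matrix_ring n R\<^esub> A = \<zero>\<^bsub>matrix_ring n R\<^esub>"
      by (intro bexI[of _ "mat n n (\<lambda>ij. \<ominus> (A $$ ij))"])
        (auto simp: matrix_ring_carrier matrix_ring_simps l_neg intro!: eq_matI)
  qed (auto simp: matrix_ring_carrier matrix_ring_simps a_ac intro!: eq_matI)
  show "Group.monoid (matrix_ring n R)"
  proof (rule monoidI)
    fix A B C
    assume A: "A \<in> carrier (matrix_ring n R)" and B: "B \<in> carrier (matrix_ring n R)"
      and C: "C \<in> carrier (matrix_ring n R)"
    have "(\<Oplus>k\<in>{..<n}. (\<Oplus>l\<in>{..<n}. A $$ (i, l) \<otimes> B $$ (l, k)) \<otimes> C $$ (k, j)) =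
        (\<Oplus>l\<in>{..<n}. A $$ (i, l) \<otimes> (\<Oplus>k\<in>{..<n}. B $$ (l, k) \<otimes> C $$ (k, j)))"
      if "i < n" "j < n" for i j
    proof -
      have "(\<Oplus>k\<in>{..<n}. (\<Oplus>l\<in>{..<n}. A $$ (i, l) \<otimes> B $$ (l, k)) \<otimes> C $$ (k, j)) =
          (\<Oplus>k\<in>{..<n}. \<Oplus>l\<in>{..<n}. A $$ (i, l) \<otimes> B $$ (l, k) \<otimes> C $$ (k, j))"
        using A B C that
        by (intro finsum_cong' finsum_ldistr) (auto simp: matrix_ring_carrier intro!: finsum_closed)
      also have "\<dots> = (\<Oplus>l\<in>{..<n}. \<Oplus>k\<in>{..<n}. A $$ (i, l) \<otimes> B $$ (l, k) \<otimes> C $$ (k, j))"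
        using A B C that by (intro finsum_swap) (auto simp: matrix_ring_carrier)
      also have "\<dots> = (\<Oplus>l\<in>{..<n}. \<Oplus>k\<in>{..<n}. A $$ (i, l) \<otimes> (B $$ (l, k) \<otimes> C $$ (k, j)))"
        using A B C that
        by (intro finsum_cong' refl) (auto simp: matrix_ring_carrier m_assoc intro!: finsum_closed)
      also have "\<dots> = (\<Oplus>l\<in>{..<n}. A $$ (i, l) \<otimes> (\<Oplus>k\<in>{..<n}. B $$ (l, k) \<otimes> C $$ (k, j)))"
        using A B C that
        by (intro finsum_cong' finsum_rdistr[symmetric])
          (auto simp: matrix_ring_carrier intro!: finsum_closed)
      finally show ?thesis .
    qed
    then show "A \<otimes>\<^bsub>matrix_ring n R\<^esub> B \<otimes>\<^bsub>matrix_ring n R\<^esub> C =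
        A \<otimes>\<^bsub>matrix_ring n R\<^esub> (B \<otimes>\<^bsub>matrix_ring n R\<^esub> C)"
      unfolding matrix_ring_simps by (intro eq_matI) (auto cong: finsum_cong_simp)
  next
    fix A assume A: "A \<in> carrier (matrix_ring n R)"
    have "(\<Oplus>k\<in>{..<n}. (if i = k then \<one> else \<zero>) \<otimes> A $$ (k, j)) = A $$ (i, j)"
      if "i < n" "j < n" for i j
      using A that by (subst finsum_single[of _ i]) (auto simp: matrix_ring_carrier)
    then show "\<one>\<^bsub>matrix_ring n R\<^esub> \<otimes>\<^bsub>matrix_ring n R\<^esub> A = A"
      using A unfolding matrix_ring_simps
      by (intro eq_matI) (auto simp: matrix_ring_carrier cong: finsum_cong_simp)
    have "(\<Oplus>k\<in>{..<n}. A $$ (i, k) \<otimes> (if k = j then \<one> else \<zero>)) = A $$ (i, j)"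
      if "i < n" "j < n" for i j
      using A that by (subst finsum_single[of _ j]) (auto simp: matrix_ring_carrier)
    then show "A \<otimes>\<^bsub>matrix_ring n R\<^esub> \<one>\<^bsub>matrix_ring n R\<^esub> = A"
      using A unfolding matrix_ring_simps
      by (intro eq_matI) (auto simp: matrix_ring_carrier cong: finsum_cong_simp)
  qed (auto simp: matrix_ring_carrier matrix_ring_simps intro!: finsum_closed)
  fix A B C
  assume A: "A \<in> carrier (matrix_ring n R)" and B: "B \<in> carrier (matrix_ring n R)"
    and C: "C \<in> carrier (matrix_ring n R)"
  have "(\<Oplus>k\<in>{..<n}. (A $$ (i, k) \<oplus> B $$ (i, k)) \<otimes> C $$ (k, j)) =
      (\<Oplus>k\<in>{..<n}. A $$ (i, k) \<otimes> C $$ (k, j)) \<oplus> (\<Oplus>k\<in>{..<n}. B $$ (i, k) \<otimes> C $$ (k, j))"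
    if "i < n" "j < n" for i j
    using A B C that by (simp add: matrix_ring_carrier l_distr Pi_iff cong: finsum_cong_simp)
  then show "(A \<oplus>\<^bsub>matrix_ring n R\<^esub> B) \<otimes>\<^bsub>matrix_ring n R\<^esub> C =
      A \<otimes>\<^bsub>matrix_ring n R\<^esub> C \<oplus>\<^bsub>matrix_ring n R\<^esub> B \<otimes>\<^bsub>matrix_ring n R\<^esub> C"
    unfolding matrix_ring_simps by (intro eq_matI) (auto cong: finsum_cong_simp)
  have "(\<Oplus>k\<in>{..<n}. C $$ (i, k) \<otimes> (A $$ (k, j) \<oplus> B $$ (k, j))) =
      (\<Oplus>k\<in>{..<n}. C $$ (i, k) \<otimes> A $$ (k, j)) \<oplus> (\<Oplus>k\<in>{..<n}. C $$ (i, k) \<otimes> B $$ (k, j))"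
    if "i < n" "j < n" for i j
    using A B C that by (simp add: matrix_ring_carrier r_distr Pi_iff cong: finsum_cong_simp)
  then show "C \<otimes>\<^bsub>matrix_ring n R\<^esub> (A \<oplus>\<^bsub>matrix_ring n R\<^esub> B) =
      C \<otimes>\<^bsub>matrix_ring n R\<^esub> A \<oplus>\<^bsub>matrix_ring n R\<^esub> C \<otimes>\<^bsub>matrix_ring n R\<^esub> B"
    unfolding matrix_ring_simps by (intro eq_matI) (auto cong: finsum_cong_simp)
qed

lemma elementary_mat_carrier: "d \<in> carrier R \<Longrightarrow> elementary_mat R n i j d \<in> carrier (matrix_ring n R)"
  by (auto simp: matrix_ring_carrier elementary_mat_def)

lemma elementary_mat_mult:
  assumes "A \<in> carrier (matrix_ring n R)" "d \<in> carrier R" "i < n" "j < n"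
  shows "elementary_mat R n i j d \<otimes>\<^bsub>matrix_ring n R\<^esub> A =
    mat n n (\<lambda>(a, b). if a = i then d \<otimes> A $$ (j, b) else \<zero>)"
proof -
  have "(\<Oplus>k\<in>{..<n}. (if a = i \<and> k = j then d else \<zero>) \<otimes> A $$ (k, b)) =
      (if a = i then d \<otimes> A $$ (j, b) else \<zero>)" if "a < n" "b < n" for a b
    using assms that by (subst finsum_single[of _ j]) (auto simp: matrix_ring_carrier)
  then show ?thesis
    unfolding matrix_ring_simps elementary_mat_def
    by (intro eq_matI) (auto cong: finsum_cong_simp)
qed

text \<open>Left multiplication by the diagonal unit at i retains only row i of A. If the entry at
  (i, j) is nonzero with right inverse d, the matrix with sole entry d at (j, i) turns that row back
  into the diagonal unit.\<close>

lemma minimal_idempotent_elementary_mat: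
  assumes "division_ring R" "i < n"
  shows "minimal_idempotent (matrix_ring n R) (elementary_mat R n i i \<one>)"
  unfolding minimal_idempotent_def
proof (intro conjI ballI impI)
  let ?M = "matrix_ring n R" and ?E = "elementary_mat R n i i \<one>"
  have units: "Units R = carrier R - {\<zero>}" using assms(1) by (simp add: division_ring_def)
  then have "\<one> \<noteq> \<zero>" using Units_one_closed by auto
  show E: "?E \<in> carrier ?M" by (simp add: elementary_mat_carrier)
  show "?E \<otimes>\<^bsub>?M\<^esub> ?E = ?E"
    unfolding elementary_mat_mult[OF E one_closed assms(2) assms(2)]
    using assms(2) by (intro eq_matI) (auto simp: elementary_mat_def)
  have "?E $$ (i, i) = \<one>" using assms(2) by (simp add: elementary_mat_def)
  moreover have "\<zero>\<^bsub>?M\<^esub> $$ (i, i) = \<zero>" using assms(2) by (simp add: matrix_ring_simps)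
  ultimately show "?E \<noteq> \<zero>\<^bsub>?M\<^esub>" using \<open>\<one> \<noteq> \<zero>\<close> by metis
  fix A assume A: "A \<in> carrier ?M" "?E \<otimes>\<^bsub>?M\<^esub> A \<noteq> \<zero>\<^bsub>?M\<^esub>"
  note EA = elementary_mat_mult[OF A(1) one_closed assms(2) assms(2)]
  have "\<exists>j<n. A $$ (i, j) \<noteq> \<zero>"
  proof (rule ccontr)
    assume "\<not> ?thesis"
    then have "?E \<otimes>\<^bsub>?M\<^esub> A = \<zero>\<^bsub>?M\<^esub>"
      unfolding EA using assms(2) by (auto simp: matrix_ring_simps intro!: eq_matI)
    then show False using A(2) by simp
  qed
  then obtain j where j: "j < n" "A $$ (i, j) \<noteq> \<zero>" by auto
  then have "A $$ (i, j) \<in> Units R"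
    using A(1) assms(2) by (auto simp: units matrix_ring_carrier)
  then obtain d where d: "d \<in> carrier R" "A $$ (i, j) \<otimes> d = \<one>" by (auto simp: Units_def)
  have "(\<Oplus>k\<in>{..<n}. (if a = i then \<one> \<otimes> A $$ (i, k) else \<zero>) \<otimes> (if k = j \<and> b = i then d else \<zero>)) =
      (if a = i \<and> b = i then \<one> else \<zero>)" if "a < n" "b < n" for a b
    using A(1) assms(2) j d that by (subst finsum_single[of _ j]) (auto simp: matrix_ring_carrier)
  then have "?E \<otimes>\<^bsub>?M\<^esub> A \<otimes>\<^bsub>?M\<^esub> elementary_mat R n j i d = ?E"
    unfolding EA unfolding matrix_ring_simps elementary_mat_def
    by (intro eq_matI) (auto cong: finsum_cong_simp)
  then show "\<exists>S\<in>carrier ?M. ?E \<otimes>\<^bsub>?M\<^esub> A \<otimes>\<^bsub>?M\<^esub> S = ?E"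
    using elementary_mat_carrier[OF d(1)] by blast
qed

lemma orthogonal_idempotent_sum_matrix_ring:
  assumes "division_ring R"
  shows "orthogonal_idempotent_sum (matrix_ring n R) \<one>\<^bsub>matrix_ring n R\<^esub>"
proof -
  let ?M = "matrix_ring n R"
  \<comment> \<open>The sum of the first k diagonal units, running from the zero matrix to the
    identity.\<close>
  define d where "d k = mat n n (\<lambda>(i, j). if i = j \<and> i < k then \<one> else \<zero>)" for k
  have dc: "d k \<in> carrier ?M" for k by (auto simp: d_def matrix_ring_carrier)
  have "orthogonal_idempotent_sum ?M (d k)" if "k \<le> n" for k
    using that
  proof (induction k)
    case 0
    have "d 0 = \<zero>\<^bsub>?M\<^esub>" by (auto simp: d_def matrix_ring_simps intro!: eq_matI)
    then show ?case by (simp add: orthogonal_idempotent_sum.zero)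
  next
    case (Suc k)
    let ?E = "elementary_mat R n k k \<one>"
    have k: "k < n" using Suc.prems by simp
    have "d (Suc k) = d k \<oplus>\<^bsub>?M\<^esub> ?E"
      by (auto simp: d_def elementary_mat_def matrix_ring_simps intro!: eq_matI)
    moreover have "?E \<otimes>\<^bsub>?M\<^esub> d k = \<zero>\<^bsub>?M\<^esub>"
      unfolding elementary_mat_mult[OF dc one_closed k k]
      using k by (auto simp: d_def matrix_ring_simps intro!: eq_matI)
    moreover have "d k \<otimes>\<^bsub>?M\<^esub> ?E = \<zero>\<^bsub>?M\<^esub>"
    proof -
      have "(\<Oplus>l\<in>{..<n}. (if a = l \<and> a < k then \<one> else \<zero>) \<otimes> (if l = k \<and> b = k then \<one> else \<zero>)) = \<zero>"
        for a b
      proof -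
        have "(\<Oplus>l\<in>{..<n}. (if a = l \<and> a < k then \<one> else \<zero>) \<otimes> (if l = k \<and> b = k then \<one> else \<zero>)) =
            (\<Oplus>l\<in>{..<n}. \<zero>)"
          by (intro finsum_cong') auto
        then show ?thesis by simp
      qed
      then show ?thesis
        unfolding matrix_ring_simps d_def elementary_mat_def
        by (intro eq_matI) (auto cong: finsum_cong_simp)
    qed
    ultimately show ?case
      using Suc minimal_idempotent_elementary_mat[OF assms k] by (auto intro: orthogonal_idempotent_sum.add)
  qed
  moreover have "d n = \<one>\<^bsub>?M\<^esub>" by (auto simp: d_def matrix_ring_simps intro!: eq_matI)
  ultimately show ?thesis by (metis order_refl)
qed

end

section \<open>Idempotent sums under isomorphisms and direct products\<close>

lemma orthogonal_idempotent_sum_carrier: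
  assumes "ring R" "orthogonal_idempotent_sum R g"
  shows "g \<in> carrier R"
proof -
  interpret ring R by fact
  show ?thesis
    using assms(2) by induction (auto simp: minimal_idempotent_def)
qed

text \<open>Injectivity keeps the image of a minimal idempotent nonzero, and surjectivity pulls a
  test element of \<open>S\<close> back to \<open>R\<close>, where minimality applies.\<close>

lemma orthogonal_idempotent_sum_iso:
  assumes "ring R" "ring S" "h \<in> ring_iso R S" "orthogonal_idempotent_sum R g"
  shows "orthogonal_idempotent_sum S (h g)"
proof -
  interpret R: ring R by fact
  interpret S: ring S by fact
  have mult: "\<And>x y. \<lbrakk>x \<in> carrier R; y \<in> carrier R\<rbrakk> \<Longrightarrow> h (x \<otimes>\<^bsub>R\<^esub> y) = h x \<otimes>\<^bsub>S\<^esub> h y"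
    and h_add: "\<And>x y. \<lbrakk>x \<in> carrier R; y \<in> carrier R\<rbrakk> \<Longrightarrow> h (x \<oplus>\<^bsub>R\<^esub> y) = h x \<oplus>\<^bsub>S\<^esub> h y"
    and clos: "\<And>x. x \<in> carrier R \<Longrightarrow> h x \<in> carrier S"
    using assms(3) by (auto simp: ring_iso_memE)
  have bij: "bij_betw h (carrier R) (carrier S)" using assms(3) by (rule ring_iso_memE)
  have h_zero: "h \<zero>\<^bsub>R\<^esub> = \<zero>\<^bsub>S\<^esub>"
    using assms(1-3) by (intro ring_hom_zero) (auto simp: ring_iso_def)
  have zero_iff: "h x = \<zero>\<^bsub>S\<^esub> \<longleftrightarrow> x = \<zero>\<^bsub>R\<^esub>" if "x \<in> carrier R" for x
    using bij that h_zero by (metis R.zero_closed bij_betw_def inj_onD)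
  have min: "minimal_idempotent S (h e)" if e: "minimal_idempotent R e" for e
    unfolding minimal_idempotent_def
  proof (intro conjI ballI impI)
    have ec: "e \<in> carrier R" "e \<otimes>\<^bsub>R\<^esub> e = e" "e \<noteq> \<zero>\<^bsub>R\<^esub>"
      using e by (auto simp: minimal_idempotent_def)
    show "h e \<in> carrier S" "h e \<otimes>\<^bsub>S\<^esub> h e = h e" "h e \<noteq> \<zero>\<^bsub>S\<^esub>"
      using ec clos mult[of e e] zero_iff by auto
    fix s assume s: "s \<in> carrier S" "h e \<otimes>\<^bsub>S\<^esub> s \<noteq> \<zero>\<^bsub>S\<^esub>"
    then obtain r where r: "r \<in> carrier R" "s = h r" using bij by (auto simp: bij_betw_def)
    then have "e \<otimes>\<^bsub>R\<^esub> r \<noteq> \<zero>\<^bsub>R\<^esub>" using s ec h_zero mult[of e r] by auto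
    then obtain t where t: "t \<in> carrier R" "e \<otimes>\<^bsub>R\<^esub> r \<otimes>\<^bsub>R\<^esub> t = e"
      using e r by (auto simp: minimal_idempotent_def)
    then have "h e \<otimes>\<^bsub>S\<^esub> s \<otimes>\<^bsub>S\<^esub> h t = h e" using ec r by (simp flip: mult)
    then show "\<exists>t\<in>carrier S. h e \<otimes>\<^bsub>S\<^esub> s \<otimes>\<^bsub>S\<^esub> t = h e" using clos t by blast
  qed
  from assms(4) show ?thesis
  proof induction
    case zero
    show ?case by (simp add: h_zero orthogonal_idempotent_sum.zero)
  next
    case (add g e)
    have car: "g \<in> carrier R" "e \<in> carrier R"
      using add orthogonal_idempotent_sum_carrier[OF assms(1)] by (auto simp: minimal_idempotent_def)
    then show ?case
      using add min[OF add.hyps(2)] mult[of e g] mult[of g e] h_zero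
      by (auto simp: h_add intro!: orthogonal_idempotent_sum.add)
  qed
qed

lemma RDirProd_simps:
  "carrier (RDirProd R S) = carrier R \<times> carrier S"
  "(a, b) \<otimes>\<^bsub>RDirProd R S\<^esub> (c, d) = (a \<otimes>\<^bsub>R\<^esub> c, b \<otimes>\<^bsub>S\<^esub> d)"
  "(a, b) \<oplus>\<^bsub>RDirProd R S\<^esub> (c, d) = (a \<oplus>\<^bsub>R\<^esub> c, b \<oplus>\<^bsub>S\<^esub> d)"
  "\<one>\<^bsub>RDirProd R S\<^esub> = (\<one>\<^bsub>R\<^esub>, \<one>\<^bsub>S\<^esub>)"
  "\<zero>\<^bsub>RDirProd R S\<^esub> = (\<zero>\<^bsub>R\<^esub>, \<zero>\<^bsub>S\<^esub>)"
  by (simp_all add: RDirProd_def DirProd_def monoid.defs)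

text \<open>Summands are padded by zero and stay minimal, since (e, 0)(r, s) = (er, 0). Padded
  summands from different factors are orthogonal, so the induction for \<open>S\<close> can start
  from the result of the induction for \<open>R\<close>.\<close>

lemma orthogonal_idempotent_sum_RDirProd:
  assumes "ring R" "ring S" "orthogonal_idempotent_sum R a" "orthogonal_idempotent_sum S b"
  shows "orthogonal_idempotent_sum (RDirProd R S) (a, b)"
proof -
  interpret R: ring R by fact
  interpret S: ring S by fact
  have a: "a \<in> carrier R" by (rule orthogonal_idempotent_sum_carrier[OF assms(1,3)])
  have left: "minimal_idempotent (RDirProd R S) (e, \<zero>\<^bsub>S\<^esub>)" if "minimal_idempotent R e" for e
    using that by (force simp: minimal_idempotent_def RDirProd_simps)
  have right: "minimal_idempotent (RDirProd R S) (\<zero>\<^bsub>R\<^esub>, e)" if "minimal_idempotent S e" for e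
    using that by (force simp: minimal_idempotent_def RDirProd_simps)
  have base: "orthogonal_idempotent_sum (RDirProd R S) (a, \<zero>\<^bsub>S\<^esub>)"
    using assms(3)
  proof induction
    case zero
    then show ?case
      using orthogonal_idempotent_sum.zero[of "RDirProd R S"] by (simp add: RDirProd_simps)
  next
    case (add g e)
    then show ?case
      using orthogonal_idempotent_sum.add[OF add.IH left[OF add.hyps(2)]]
      by (simp add: RDirProd_simps)
  qed
  show ?thesis
    using assms(4)
  proof induction
    case zero
    then show ?case by (rule base)
  next
    case (add g e)
    then show ?case
      using orthogonal_idempotent_sum.add[OF add.IH right[OF add.hyps(2)]] a
        minimal_idempotent_def[of S e]
      by (auto simp: RDirProd_simps)
  qed
qed

lemma orthogonal_idempotent_sum_RDirProd_list:
  assumes "\<And>S. S \<in> set Ss \<Longrightarrow> ring S \<and> orthogonal_idempotent_sum S \<one>\<^bsub>S\<^esub>"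
  shows "orthogonal_idempotent_sum (RDirProd_list Ss) \<one>\<^bsub>RDirProd_list Ss\<^esub>"
  using assms
proof (induction Ss)
  case Nil
  \<comment> \<open>The empty product is the zero ring, where one and zero coincide.\<close>
  show ?case
    using orthogonal_idempotent_sum.zero[of "RDirProd_list []"]
    by (simp add: RDirProd_list_one RDirProd_list_zero del: RDirProd_list_nil)
next
  case (Cons S Ss)
  have ring_list: "ring (RDirProd_list Ts)" if "set Ts \<subseteq> set (S # Ss)" for Ts
    using Cons.prems that nth_mem by (intro RDirProd_list_is_ring) blast
  then have rings: "ring S" "ring (RDirProd_list Ss)" "ring (RDirProd_list (S # Ss))"
    using Cons.prems by auto
  have "orthogonal_idempotent_sum (RDirProd S (RDirProd_list Ss)) (\<one>\<^bsub>S\<^esub>, \<one>\<^bsub>RDirProd_list Ss\<^esub>)"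
    using Cons rings by (intro orthogonal_idempotent_sum_RDirProd) auto
  from orthogonal_idempotent_sum_iso[OF RDirProd_ring[OF rings(1,2)] rings(3) RDirProd_list_iso1 this]
  show ?case by (simp add: RDirProd_list_one)
qed

lemma (in ring) orthogonal_idempotent_sum_if_product_of_matrix_rings:
  assumes "product_of_matrix_rings TYPE('d) R"
  shows "orthogonal_idempotent_sum R \<one>"
proof -
  obtain Ds :: "(nat \<times> 'd ring) list" where Ds: "\<forall>(n, D)\<in>set Ds. n \<ge> 1 \<and> division_ring D"
    and "R \<simeq> RDirProd_list (map (\<lambda>(n, D). matrix_ring n D) Ds)"
    using assms unfolding product_of_matrix_rings_def by blast
  then obtain h where h: "h \<in> ring_iso R (RDirProd_list (map (\<lambda>(n, D). matrix_ring n D) Ds))"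
    unfolding is_ring_iso_def by blast
  let ?Ss = "map (\<lambda>(n, D). matrix_ring n D) Ds"
  have S: "ring S \<and> orthogonal_idempotent_sum S \<one>\<^bsub>S\<^esub>" if S: "S \<in> set ?Ss" for S
  proof -
    obtain n D where D: "(n, D) \<in> set Ds" "S = matrix_ring n D" using S by auto
    then have "division_ring D" "ring D" using Ds by (auto simp: division_ring_def)
    then show ?thesis
      using D ring.ring_matrix_ring ring.orthogonal_idempotent_sum_matrix_ring by auto
  qed
  have ring: "ring (RDirProd_list ?Ss)" using S by (intro RDirProd_list_is_ring) (metis nth_mem)
  let ?g = "inv_into (carrier R) h"
  have g: "?g \<in> ring_iso (RDirProd_list ?Ss) R"
    using ring_iso_set_sym[OF ring_axioms h] .
  have "orthogonal_idempotent_sum R (?g \<one>\<^bsub>RDirProd_list ?Ss\<^esub>)"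
    by (rule orthogonal_idempotent_sum_iso[OF ring ring_axioms g orthogonal_idempotent_sum_RDirProd_list[OF S]])
  moreover have "?g \<one>\<^bsub>RDirProd_list ?Ss\<^esub> = \<one>" using g by (rule ring_iso_memE)
  ultimately show ?thesis by simp
qed

section \<open>Corner rings and the Peirce decomposition\<close>

text \<open>For an idempotent e this is the Peirce corner eRe, written as the set of elements fixed
  by e on both sides. Only carrier and unit change, so it lives in the type of
  \<open>R\<close>.\<close>

definition corner_ring :: "('a, 'm) ring_scheme \<Rightarrow> 'a \<Rightarrow> 'a ring" where
  "corner_ring R e =
    \<lparr>carrier = {x \<in> carrier R. e \<otimes>\<^bsub>R\<^esub> x = x \<and> x \<otimes>\<^bsub>R\<^esub> e = x},
     monoid.mult = monoid.mult R, one = e, zero = zero R, add = add R\<rparr>"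

lemma corner_ring_simps [simp]:
  "x \<in> carrier (corner_ring R e) \<longleftrightarrow> x \<in> carrier R \<and> e \<otimes>\<^bsub>R\<^esub> x = x \<and> x \<otimes>\<^bsub>R\<^esub> e = x"
  "x \<otimes>\<^bsub>corner_ring R e\<^esub> y = x \<otimes>\<^bsub>R\<^esub> y"
  "\<one>\<^bsub>corner_ring R e\<^esub> = e"
  "\<zero>\<^bsub>corner_ring R e\<^esub> = \<zero>\<^bsub>R\<^esub>"
  "x \<oplus>\<^bsub>corner_ring R e\<^esub> y = x \<oplus>\<^bsub>R\<^esub> y"
  by (simp_all add: corner_ring_def)

context ring
begin

lemma ring_corner_ring:
  assumes "e \<in> carrier R" "e \<otimes> e = e"
  shows "ring (corner_ring R e)"
proof (rule ringI)
  show "abelian_group (corner_ring R e)"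
  proof (rule abelian_groupI)
    fix x assume "x \<in> carrier (corner_ring R e)"
    then show "\<exists>y\<in>carrier (corner_ring R e). y \<oplus>\<^bsub>corner_ring R e\<^esub> x = \<zero>\<^bsub>corner_ring R e\<^esub>"
      using assms by (intro bexI[of _ "\<ominus> x"]) (auto simp: l_neg r_minus l_minus)
  qed (use assms in \<open>auto simp: a_ac l_distr r_distr\<close>)
  show "Group.monoid (corner_ring R e)"
    by (rule monoidI) (use assms in \<open>auto simp: m_assoc simp flip: m_assoc[of e]\<close>)
qed (auto simp: l_distr r_distr)

text \<open>Matrix products over a corner are sums in the corner, while the computations with
  idempotents take place in \<open>R\<close>.\<close>

lemma finsum_corner_ring:
  assumes "e \<in> carrier R" "e \<otimes> e = e" "f \<in> A \<rightarrow> carrier (corner_ring R e)"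
  shows "finsum (corner_ring R e) f A = finsum R f A"
proof -
  interpret C: ring "corner_ring R e" by (rule ring_corner_ring[OF assms(1,2)])
  show ?thesis
  proof (cases "finite A")
    case True
    then show ?thesis
      using assms(3)
    proof (induction A)
      case empty
      then show ?case by simp
    next
      case (insert x A)
      then have "f \<in> A \<rightarrow> carrier R" "f x \<in> carrier R" by auto
      with insert show ?case by (simp add: Pi_iff)
    qed
  qed (simp add: finsum_infinite C.finsum_infinite)
qed

text \<open>Minimality gives right inverses only, and cutting them down by e on both sides places
  them in the corner. Such an inverse y of x is nonzero and so has a right inverse z itself; then x
  = xyz = z, and y is two-sided.\<close>

lemma division_ring_corner_ring:
  assumes "minimal_idempotent R e"
  shows "division_ring (corner_ring R e)"
proof -
  have e: "e \<in> carrier R" "e \<otimes> e = e" "e \<noteq> \<zero>"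
    and min: "\<And>r. \<lbrakk>r \<in> carrier R; e \<otimes> r \<noteq> \<zero>\<rbrakk> \<Longrightarrow> \<exists>s\<in>carrier R. e \<otimes> r \<otimes> s = e"
    using assms by (auto simp: minimal_idempotent_def)
  interpret C: ring "corner_ring R e" by (rule ring_corner_ring[OF e(1,2)])
  have right_inverse: "\<exists>y\<in>carrier (corner_ring R e). y \<noteq> \<zero> \<and> x \<otimes> y = e"
    if x: "x \<in> carrier (corner_ring R e)" "x \<noteq> \<zero>" for x
  proof -
    have xc: "x \<in> carrier R" using x by simp
    obtain s where s: "s \<in> carrier R" "x \<otimes> s = e" using min[of x] x by auto
    have "x \<otimes> (e \<otimes> s \<otimes> e) = e"
    proof -
      have "x \<otimes> (e \<otimes> s \<otimes> e) = x \<otimes> e \<otimes> s \<otimes> e" using xc s(1) e(1) by (simp add: m_assoc)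
      then show ?thesis using x s e by simp
    qed
    moreover have "e \<otimes> s \<otimes> e \<in> carrier (corner_ring R e)"
      using e s(1) by (auto simp: m_assoc) (simp flip: m_assoc)
    ultimately show ?thesis using x e by (intro bexI[of _ "e \<otimes> s \<otimes> e"]) auto
  qed
  have "x \<in> Units (corner_ring R e)" if x: "x \<in> carrier (corner_ring R e)" "x \<noteq> \<zero>" for x
  proof -
    obtain y where y: "y \<in> carrier (corner_ring R e)" "y \<noteq> \<zero>" "x \<otimes> y = e"
      using right_inverse[OF x] by auto
    obtain z where z: "z \<in> carrier (corner_ring R e)" "y \<otimes> z = e"
      using right_inverse[OF y(1,2)] by auto
    have "x = x \<otimes> (y \<otimes> z)" using x z by simp
    also have "\<dots> = x \<otimes> y \<otimes> z" using x(1) y(1) z(1) by (simp add: m_assoc)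
    also have "\<dots> = z" using y(3) z(1) by simp
    finally show ?thesis using x y z by (auto simp: Units_def)
  qed
  moreover have "x \<noteq> \<zero>" if "x \<in> Units (corner_ring R e)" for x
    using that e(3) by (auto simp: Units_def)
  ultimately have "Units (corner_ring R e) = carrier (corner_ring R e) - {\<zero>\<^bsub>corner_ring R e\<^esub>}"
    using C.Units_closed unfolding corner_ring_simps(4) by blast
  then show ?thesis unfolding division_ring_def using C.ring_axioms by simp
qed

section \<open>Orthogonal families and isomorphic minimal idempotents\<close>

text \<open>The relations eg = e = ge are carried along because they turn orthogonality to the
  partial sum into orthogonality to each summand: fe = fge = 0, and likewise on the other
  side.\<close>

lemma orthogonal_idempotent_sum_set:
  assumes "orthogonal_idempotent_sum R g"
  shows "\<exists>E. finite E \<and> (\<forall>e\<in>E. minimal_idempotent R e \<and> e \<otimes> g = e \<and> g \<otimes> e = e) \<and>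
    (\<forall>e\<in>E. \<forall>f\<in>E. e \<noteq> f \<longrightarrow> e \<otimes> f = \<zero>) \<and> (\<Oplus>e\<in>E. e) = g"
  using assms
proof induction
  case zero
  show ?case by (intro exI[of _ "{}"]) simp
next
  case (add g f)
  then obtain E where E: "finite E" "\<And>e. e \<in> E \<Longrightarrow> minimal_idempotent R e"
    "\<And>e. e \<in> E \<Longrightarrow> e \<otimes> g = e" "\<And>e. e \<in> E \<Longrightarrow> g \<otimes> e = e"
    "\<And>e f. \<lbrakk>e \<in> E; f \<in> E; e \<noteq> f\<rbrakk> \<Longrightarrow> e \<otimes> f = \<zero>" "(\<Oplus>e\<in>E. e) = g"
    by blast
  have f: "f \<in> carrier R" "f \<otimes> f = f" "f \<noteq> \<zero>"
    using add.hyps(2) by (auto simp: minimal_idempotent_def)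
  have g: "g \<in> carrier R"
    using orthogonal_idempotent_sum_carrier[OF ring_axioms add.hyps(1)] .
  have Ec: "\<And>e. e \<in> E \<Longrightarrow> e \<in> carrier R" using E(2) by (auto simp: minimal_idempotent_def)
  have fe: "f \<otimes> e = \<zero>" if "e \<in> E" for e
  proof -
    have "f \<otimes> e = f \<otimes> g \<otimes> e" using E(4)[OF that] Ec[OF that] f g by (simp add: m_assoc)
    then show ?thesis using add.hyps Ec[OF that] by simp
  qed
  have ef: "e \<otimes> f = \<zero>" if "e \<in> E" for e
  proof -
    have "e \<otimes> f = e \<otimes> (g \<otimes> f)" using E(3)[OF that] Ec[OF that] f g by (simp flip: m_assoc)
    then show ?thesis using add.hyps Ec[OF that] by simp
  qed
  \<comment> \<open>A set suffices in place of a list: f kills every member of E from the left, but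
    not itself.\<close>
  have "f \<notin> E" using fe f by fastforce
  then have "(\<Oplus>e\<in>insert f E. e) = g \<oplus> f"
    using E(1,6) Ec f g by (simp add: Pi_iff a_comm)
  moreover have "e \<otimes> (g \<oplus> f) = e \<and> (g \<oplus> f) \<otimes> e = e" if "e \<in> insert f E" for e
    using that f g E(3,4) Ec fe ef add.hyps by (auto simp: r_distr l_distr)
  ultimately show ?case
    using E(1,2,5) add.hyps(2) fe ef by (intro exI[of _ "insert f E"]) auto
qed

text \<open>For minimal idempotents $e$, $f$, a nonzero element of $eRf$ amounts to an isomorphism
  $fR \cong eR$; here $u$ and $v$ are such an isomorphism and its inverse.\<close>

lemma minimal_idempotents_isomorphic:
  assumes e: "minimal_idempotent R e" and f: "minimal_idempotent R f"
    and r: "r \<in> carrier R" "e \<otimes> r \<otimes> f \<noteq> \<zero>"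
  shows "\<exists>u\<in>carrier R. \<exists>v\<in>carrier R. e \<otimes> u = u \<and> u \<otimes> f = u \<and> f \<otimes> v = v \<and> v \<otimes> e = v \<and>
    u \<otimes> v = e \<and> v \<otimes> u = f"
proof -
  have ec: "e \<in> carrier R" "e \<otimes> e = e" "e \<noteq> \<zero>"
    and min_e: "\<And>r. \<lbrakk>r \<in> carrier R; e \<otimes> r \<noteq> \<zero>\<rbrakk> \<Longrightarrow> \<exists>s\<in>carrier R. e \<otimes> r \<otimes> s = e"
    using e by (auto simp: minimal_idempotent_def)
  have fc: "f \<in> carrier R" "f \<otimes> f = f"
    and min_f: "\<And>r. \<lbrakk>r \<in> carrier R; f \<otimes> r \<noteq> \<zero>\<rbrakk> \<Longrightarrow> \<exists>s\<in>carrier R. f \<otimes> r \<otimes> s = f"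
    using f by (auto simp: minimal_idempotent_def)
  define u where "u = e \<otimes> r \<otimes> f"
  have u: "u \<in> carrier R" "e \<otimes> u = u" "u \<otimes> f = u"
    using ec fc r(1) by (simp_all add: u_def m_assoc) (simp flip: m_assoc)
  obtain s where s: "s \<in> carrier R" "u \<otimes> s = e"
    using min_e[of u] u r(2) by (auto simp: u_def)
  \<comment> \<open>The right partner s of u is cut down to an element of fRe.\<close>
  define v where "v = f \<otimes> s \<otimes> e"
  have v: "v \<in> carrier R" "f \<otimes> v = v" "v \<otimes> e = v"
    using ec fc s(1) by (simp_all add: v_def m_assoc) (simp flip: m_assoc)
  have uv: "u \<otimes> v = e"
  proof -
    have "u \<otimes> v = u \<otimes> f \<otimes> s \<otimes> e" using u(1) fc(1) s(1) ec(1) by (simp add: v_def m_assoc)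
    then show ?thesis using u s ec by simp
  qed
  \<comment> \<open>The product vu is a nonzero idempotent in fRf. Minimality of f gives pt = f,
    whence p = pf = ppt = pt = f.\<close>
  define p where "p = v \<otimes> u"
  have p: "p \<in> carrier R" "f \<otimes> p = p" "p \<otimes> f = p"
    using u v fc by (simp_all add: p_def m_assoc) (simp flip: m_assoc)
  have up: "u \<otimes> p = u"
    using u v uv by (simp add: p_def flip: m_assoc)
  have pp: "p \<otimes> p = p"
  proof -
    have "p \<otimes> p = v \<otimes> (u \<otimes> p)" using u(1) v(1) p(1) by (simp add: p_def m_assoc)
    then show ?thesis by (simp add: up) (simp add: p_def)
  qed
  have "p \<noteq> \<zero>" using up u r(2) by (auto simp: u_def)
  then obtain t where t: "t \<in> carrier R" "p \<otimes> t = f" using min_f[of p] p by auto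
  have "p = p \<otimes> (p \<otimes> t)" using p t by simp
  also have "\<dots> = p \<otimes> p \<otimes> t" using p(1) t(1) by (simp add: m_assoc)
  also have "\<dots> = f" by (simp add: pp t(2))
  finally have "v \<otimes> u = f" by (simp add: p_def)
  then show ?thesis using u v uv by blast
qed

end

section \<open>The isomorphism onto a product of matrix rings\<close>

lemma ring_hom_RDirProd_list:
  assumes "\<And>p. p \<in> set ps \<Longrightarrow> h p \<in> Ring.ring_hom R (S p)"
  shows "(\<lambda>r. map (\<lambda>p. h p r) ps) \<in> Ring.ring_hom R (RDirProd_list (map S ps))"
  using assms
proof (induction ps)
  case Nil
  then show ?case by (auto intro!: ring_hom_memI simp: monoid.defs)
next
  case (Cons p ps)
  have comp: "(\<lambda>r. map (\<lambda>p. h p r) (p # ps)) =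
      (\<lambda>(a, as). a # as) \<circ> ((\<lambda>(x, y). (h p x, map (\<lambda>p. h p y) ps)) \<circ> (\<lambda>a. (a, a)))"
    by auto
  have "(\<lambda>(a, as). a # as) \<circ> ((\<lambda>(x, y). (h p x, map (\<lambda>p. h p y) ps)) \<circ> (\<lambda>a. (a, a)))
      \<in> Ring.ring_hom R (RDirProd_list (S p # map S ps))"
    by (rule ring_hom_trans[OF ring_hom_trans[OF RDirProd_hom1 RDirProd_hom3] RDirProd_list_hom1])
      (use Cons in auto)
  then show ?case by (simp only: comp list.map(2)[of S])
qed

text \<open>Supplies the double indexing of block matrices: p names the class and thereby the matrix
  factor, i the row within it.\<close>

lemma enumerate_equivalence_classes:
  assumes "finite E" "equiv E r"
  obtains m :: nat and n :: "nat \<Rightarrow> nat" and \<epsilon> :: "nat \<times> nat \<Rightarrow> 'a"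
  where "bij_betw \<epsilon> (SIGMA p:{..<m}. {..<n p}) E" "\<And>p. p < m \<Longrightarrow> n p \<ge> 1"
    "\<And>p q i j. \<lbrakk>p < m; q < m; i < n p; j < n q\<rbrakk> \<Longrightarrow> (\<epsilon> (p, i), \<epsilon> (q, j)) \<in> r \<longleftrightarrow> p = q"
proof -
  have "finite (E // r)"
    using assms by (simp add: equiv_type finite_quotient)
  then obtain c where c: "bij_betw c {..<card (E // r)} (E // r)"
    using ex_bij_betw_nat_finite[of "E // r"] by (auto simp: atLeast0LessThan)
  let ?m = "card (E // r)"
  define n where "n p = card (c p)" for p
  have cp: "c p \<in> E // r" if "p < ?m" for p using c that by (auto simp: bij_betw_def)
  have fin: "finite (c p)" if "p < ?m" for p
    using cp[OF that] assms by (meson equiv_type finite_equiv_class)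
  have "\<exists>d. \<forall>p<?m. bij_betw (d p) {..<n p} (c p)"
    using ex_bij_betw_nat_finite[OF fin] by (intro choice) (auto simp: n_def atLeast0LessThan)
  then obtain d where d: "\<And>p. p < ?m \<Longrightarrow> bij_betw (d p) {..<n p} (c p)" by auto
  define \<epsilon> where "\<epsilon> = (\<lambda>(p, i). d p i)"
  have mem: "\<epsilon> (p, i) \<in> c p" if "p < ?m" "i < n p" for p i
    using d[OF that(1)] that by (auto simp: \<epsilon>_def bij_betw_def)
  have rel: "(\<epsilon> (p, i), \<epsilon> (q, j)) \<in> r \<longleftrightarrow> p = q"
    if "p < ?m" "q < ?m" "i < n p" "j < n q" for p q i j
  proof -
    have "(\<epsilon> (p, i), \<epsilon> (q, j)) \<in> r \<longleftrightarrow> c p = c q"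
      using quotient_eq_iff[OF assms(2) cp[OF that(1)] cp[OF that(2)] mem[OF that(1,3)] mem[OF that(2,4)]]
      by simp
    also have "\<dots> \<longleftrightarrow> p = q"
      using c that by (auto simp: bij_betw_def inj_on_def)
    finally show ?thesis .
  qed
  have "bij_betw \<epsilon> (SIGMA p:{..<?m}. {..<n p}) E"
    unfolding bij_betw_def
  proof
    show "inj_on \<epsilon> (SIGMA p:{..<?m}. {..<n p})"
    proof (rule inj_onI)
      fix x y assume x: "x \<in> (SIGMA p:{..<?m}. {..<n p})" and y: "y \<in> (SIGMA p:{..<?m}. {..<n p})"
        and eq: "\<epsilon> x = \<epsilon> y"
      obtain p i q j where xy: "x = (p, i)" "y = (q, j)" by (metis surj_pair)
      have "c p = c q"
        using mem[of p i] mem[of q j] x y eq quotient_disj[OF assms(2) cp cp, of p q]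
        by (auto simp: xy)
      then have "p = q" using c x y by (auto simp: xy bij_betw_def inj_on_def)
      then show "x = y"
        using d[of p] x y eq by (auto simp: xy \<epsilon>_def bij_betw_def inj_on_def)
    qed
    show "\<epsilon> ` (SIGMA p:{..<?m}. {..<n p}) = E"
    proof
      show "\<epsilon> ` (SIGMA p:{..<?m}. {..<n p}) \<subseteq> E"
        using mem cp Union_quotient[OF assms(2)] by fastforce
      show "E \<subseteq> \<epsilon> ` (SIGMA p:{..<?m}. {..<n p})"
      proof
        fix x assume "x \<in> E"
        then obtain C where "C \<in> E // r" "x \<in> C" using Union_quotient[OF assms(2)] by auto
        then obtain p where p: "p < ?m" "x \<in> c p" using c by (auto simp: bij_betw_def)
        then obtain i where "i < n p" "x = d p i" using d[OF p(1)] by (auto simp: bij_betw_def)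
        then show "x \<in> \<epsilon> ` (SIGMA p:{..<?m}. {..<n p})"
          using p(1) by (auto simp: \<epsilon>_def intro!: image_eqI[of _ _ "(p, i)"])
      qed
    qed
  qed
  moreover have "n p \<ge> 1" if "p < ?m" for p
    using in_quotient_imp_non_empty[OF assms(2) cp[OF that]] fin[OF that]
    by (simp add: n_def Suc_leI card_gt_0_iff)
  ultimately show thesis using rel that by blast
qed

context ring
begin

text \<open>Two relations carry the proof. That the products u_i v_i over all classes add up to
  \<open>\<one>\<close> gives, with the vanishing of eRf across classes, multiplicativity and
  injectivity. That v_i u_j is zero or the representative gives the unit and surjectivity.\<close>

lemma product_of_matrix_rings_if_orthogonal_idempotent_sum:
  assumes "orthogonal_idempotent_sum R \<one>"
  shows "product_of_matrix_rings TYPE('a) R"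
proof -
  obtain E where E: "finite E" "\<And>e. e \<in> E \<Longrightarrow> minimal_idempotent R e"
    "\<And>e f. \<lbrakk>e \<in> E; f \<in> E; e \<noteq> f\<rbrakk> \<Longrightarrow> e \<otimes> f = \<zero>" "(\<Oplus>e\<in>E. e) = \<one>"
    using orthogonal_idempotent_sum_set[OF assms] by blast
  have Ec: "e \<in> carrier R" "e \<otimes> e = e" "e \<noteq> \<zero>" if "e \<in> E" for e
    using E(2)[OF that] by (auto simp: minimal_idempotent_def)
  \<comment> \<open>One nonzero element of eRf is all that is asked: \<open>\<one>\<close> gives
    reflexivity, and the isomorphisms obtained from such an element give symmetry and
    transitivity.\<close>
  define link where "link = {(e, f) \<in> E \<times> E. \<exists>r\<in>carrier R. e \<otimes> r \<otimes> f \<noteq> \<zero>}"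
  have iso: "\<exists>u\<in>carrier R. \<exists>v\<in>carrier R. e \<otimes> u = u \<and> u \<otimes> f = u \<and> f \<otimes> v = v \<and> v \<otimes> e = v \<and>
      u \<otimes> v = e \<and> v \<otimes> u = f" if "(e, f) \<in> link" for e f
    using that E(2) minimal_idempotents_isomorphic[of e f] by (auto simp: link_def)
  have linkI: "(e, f) \<in> link" if "e \<in> E" "f \<in> E" "r \<in> carrier R" "e \<otimes> r \<otimes> f \<noteq> \<zero>" for e f r
    using that by (auto simp: link_def)
  have "equiv E link"
  proof (rule equivI)
    show "refl_on E link"
      using Ec by (auto simp: link_def refl_on_def intro!: bexI[of _ \<one>])
    show "link \<subseteq> E \<times> E" by (auto simp: link_def)
    show "sym link"
    proof (rule symI)
      fix e f assume ef: "(e, f) \<in> link"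
      then obtain u v where "v \<in> carrier R" "f \<otimes> v = v" "v \<otimes> e = v" "u \<in> carrier R" "v \<otimes> u = f"
        using iso[OF ef] by blast
      then have "f \<otimes> v \<otimes> e \<noteq> \<zero>" using Ec(3)[of f] ef by (auto simp: link_def)
      then show "(f, e) \<in> link" using ef \<open>v \<in> carrier R\<close> by (auto simp: link_def)
    qed
    show "trans link"
    proof (rule transI)
      fix e f g assume ef: "(e, f) \<in> link" and fg: "(f, g) \<in> link"
      have mem: "e \<in> E" "f \<in> E" "g \<in> E" using ef fg by (auto simp: link_def)
      obtain r where r: "r \<in> carrier R" "e \<otimes> r \<otimes> f \<noteq> \<zero>" using ef by (auto simp: link_def)
      obtain u v where uv: "u \<in> carrier R" "v \<in> carrier R" "u \<otimes> g = u" "u \<otimes> v = f" using iso[OF fg] by blast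
      have "e \<otimes> (r \<otimes> u) \<otimes> g \<noteq> \<zero>"
      proof
        assume 0: "e \<otimes> (r \<otimes> u) \<otimes> g = \<zero>"
        have "e \<otimes> r \<otimes> f = e \<otimes> r \<otimes> (u \<otimes> g \<otimes> v)" using uv by simp
        also have "\<dots> = e \<otimes> (r \<otimes> u) \<otimes> g \<otimes> v" using uv(1,2) r(1) Ec mem by (simp add: m_assoc)
        also have "\<dots> = \<zero>" using 0 uv(2) by simp
        finally show False using r(2) by simp
      qed
      then show "(e, g) \<in> link" using mem r(1) uv(1) by (intro linkI[of _ _ "r \<otimes> u"]) auto
    qed
  qed
  then obtain m n \<epsilon> where bij: "bij_betw \<epsilon> (SIGMA p:{..<m}. {..<n p}) E"
    and n: "\<And>p. p < m \<Longrightarrow> n p \<ge> (1::nat)"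
    and link_iff: "\<And>p q i j. \<lbrakk>p < (m::nat); q < m; i < n p; j < n q\<rbrakk> \<Longrightarrow> (\<epsilon> (p, i), \<epsilon> (q, j)) \<in> link \<longleftrightarrow> p = q"
    using enumerate_equivalence_classes[OF E(1)] by metis
  have \<epsilon>E: "\<epsilon> (p, i) \<in> E" if "p < m" "i < n p" for p i
    using bij that by (auto simp: bij_betw_def)
  \<comment> \<open>The first member represents its class; index 0 is available because
    \<open>n p\<close> is at least 1.\<close>
  define \<rho> where "\<rho> p = \<epsilon> (p, 0)" for p
  have "\<exists>uv. fst uv \<in> carrier R \<and> snd uv \<in> carrier R \<and>
      \<epsilon> (p, i) \<otimes> fst uv = fst uv \<and> fst uv \<otimes> \<rho> p = fst uv \<and> \<rho> p \<otimes> snd uv = snd uv \<and>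
      snd uv \<otimes> \<epsilon> (p, i) = snd uv \<and> fst uv \<otimes> snd uv = \<epsilon> (p, i) \<and> snd uv \<otimes> fst uv = \<rho> p"
    if "p < m" "i < n p" for p i
  proof -
    have "0 < n p" using n[OF that(1)] by simp
    then have "(\<epsilon> (p, i), \<rho> p) \<in> link" using link_iff[of p p i 0] that by (simp add: \<rho>_def)
    from iso[OF this] show ?thesis by (metis fst_conv snd_conv)
  qed
  then obtain w where w: "\<And>p i. \<lbrakk>p < m; i < n p\<rbrakk> \<Longrightarrow> fst (w p i) \<in> carrier R \<and> snd (w p i) \<in> carrier R \<and>
      \<epsilon> (p, i) \<otimes> fst (w p i) = fst (w p i) \<and> fst (w p i) \<otimes> \<rho> p = fst (w p i) \<and>
      \<rho> p \<otimes> snd (w p i) = snd (w p i) \<and> snd (w p i) \<otimes> \<epsilon> (p, i) = snd (w p i) \<and>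
      fst (w p i) \<otimes> snd (w p i) = \<epsilon> (p, i) \<and> snd (w p i) \<otimes> fst (w p i) = \<rho> p"
    by metis
  define u where "u p i = fst (w p i)" for p i
  define v where "v p i = snd (w p i)" for p i
  have uv: "u p i \<in> carrier R" "v p i \<in> carrier R" "\<epsilon> (p, i) \<otimes> u p i = u p i" "u p i \<otimes> \<rho> p = u p i"
    "\<rho> p \<otimes> v p i = v p i" "v p i \<otimes> \<epsilon> (p, i) = v p i" "u p i \<otimes> v p i = \<epsilon> (p, i)" "v p i \<otimes> u p i = \<rho> p"
    if "p < m" "i < n p" for p i
    using w[OF that] by (simp_all add: u_def v_def)
  have \<rho>: "\<rho> p \<in> E" if "p < m" for p
    using \<epsilon>E[OF that, of 0] n[OF that] by (simp add: \<rho>_def)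
  \<comment> \<open>The families u and v are dual to each other, also across classes: each absorbs
    its own idempotent, and distinct idempotents are orthogonal.\<close>
  have vu: "v p i \<otimes> u q j = (if p = q \<and> i = j then \<rho> p else \<zero>)"
    if "p < m" "i < n p" "q < m" "j < n q" for p i q j
  proof (cases "p = q \<and> i = j")
    case False
    then have "\<epsilon> (p, i) \<noteq> \<epsilon> (q, j)" using bij that by (auto simp: bij_betw_def inj_on_def)
    then have 0: "\<epsilon> (p, i) \<otimes> \<epsilon> (q, j) = \<zero>" using \<epsilon>E that by (intro E(3)) auto
    have "v p i \<otimes> u q j = v p i \<otimes> \<epsilon> (p, i) \<otimes> (\<epsilon> (q, j) \<otimes> u q j)" using uv that by simp
    also have "\<dots> = v p i \<otimes> (\<epsilon> (p, i) \<otimes> \<epsilon> (q, j)) \<otimes> u q j"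
      using uv(1,2) that Ec(1)[OF \<epsilon>E] by (simp add: m_assoc)
    also have "\<dots> = \<zero>" using uv(1,2) that by (simp add: 0)
    finally show ?thesis using False by auto
  qed (use uv(8) that in auto)
  \<comment> \<open>This insertion of \<open>\<one>\<close> is what creates the summation in the
    matrix product.\<close>
  have insert_one: "x \<otimes> y = (\<Oplus>e\<in>E. x \<otimes> e \<otimes> y)" if "x \<in> carrier R" "y \<in> carrier R" for x y
  proof -
    have "x \<otimes> y = x \<otimes> (\<Oplus>e\<in>E. e) \<otimes> y" using that by (simp add: E(4))
    also have "\<dots> = (\<Oplus>e\<in>E. x \<otimes> e) \<otimes> y"
      using that Ec(1) E(1) by (subst finsum_rdistr) auto
    also have "\<dots> = (\<Oplus>e\<in>E. x \<otimes> e \<otimes> y)"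
      using that Ec(1) E(1) by (subst finsum_ldistr) auto
    finally show ?thesis .
  qed
  let ?D = "\<lambda>p. corner_ring R (\<rho> p)"
  let ?M = "\<lambda>p. matrix_ring (n p) (?D p)"
  define \<phi> where "\<phi> p r = mat (n p) (n p) (\<lambda>(i, j). v p i \<otimes> r \<otimes> u p j)" for p r
  have entry: "v p i \<otimes> r \<otimes> u p j \<in> carrier (?D p)"
    if "p < m" "i < n p" "j < n p" "r \<in> carrier R" for p i j r
    using uv[OF that(1,2)] uv[OF that(1,3)] that(4) Ec(1)[OF \<rho>[OF that(1)]]
    by (simp add: m_assoc) (simp flip: m_assoc)
  have hom: "\<phi> p \<in> Ring.ring_hom R (?M p)" if p: "p < m" for p
  proof (rule ring_hom_memI)
    fix r assume r: "r \<in> carrier R"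
    show "\<phi> p r \<in> carrier (?M p)"
      unfolding matrix_ring_carrier using entry[OF p _ _ r] by (auto simp: \<phi>_def)
    fix s assume s: "s \<in> carrier R"
    have "v p i \<otimes> (r \<otimes> s) \<otimes> u p j =
        (\<Oplus>\<^bsub>?D p\<^esub>k\<in>{..<n p}. (v p i \<otimes> r \<otimes> u p k) \<otimes> (v p k \<otimes> s \<otimes> u p j))"
      if i: "i < n p" and j: "j < n p" for i j
    proof -
      let ?g = "\<lambda>e. v p i \<otimes> r \<otimes> e \<otimes> (s \<otimes> u p j)"
      have gc: "?g e \<in> carrier R" if "e \<in> E" for e
        using uv(1,2)[OF p i] uv(1,2)[OF p j] r s Ec(1)[OF that] by simp
      \<comment> \<open>Only idempotents of class p survive, because v absorbs
        \<open>\<epsilon> (p, i)\<close> and \<open>\<epsilon> (p, i)\<close> R e = 0 for e in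
        another class. This makes each block multiplicative by itself.\<close>
      have zero: "?g e = \<zero>" if e: "e \<in> E - (\<lambda>k. \<epsilon> (p, k)) ` {..<n p}" for e
      proof -
        obtain q k where q: "q < m" "k < n q" "e = \<epsilon> (q, k)"
          using bij e by (auto simp: bij_betw_def)
        then have "q \<noteq> p" using e by auto
        then have "(\<epsilon> (p, i), e) \<notin> link" using link_iff q p i by auto
        then have 0: "\<epsilon> (p, i) \<otimes> r \<otimes> e = \<zero>" using linkI[OF \<epsilon>E[OF p i] _ r] e by auto
        have "v p i \<otimes> r \<otimes> e = v p i \<otimes> (\<epsilon> (p, i) \<otimes> r \<otimes> e)"
          using uv(2,6)[OF p i] r e Ec(1) \<epsilon>E[OF p i] by (simp flip: m_assoc)
        also have "\<dots> = \<zero>" using uv(2)[OF p i] by (simp add: 0)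
        finally show ?thesis using uv(1)[OF p j] s by simp
      qed
      have "v p i \<otimes> (r \<otimes> s) \<otimes> u p j = v p i \<otimes> r \<otimes> (s \<otimes> u p j)"
        using uv(1)[OF p j] uv(2)[OF p i] r s by (simp add: m_assoc)
      also have "\<dots> = (\<Oplus>e\<in>E. ?g e)"
        using uv(1)[OF p j] uv(2)[OF p i] r s by (intro insert_one) auto
      also have "\<dots> = (\<Oplus>e\<in>(\<lambda>k. \<epsilon> (p, k)) ` {..<n p}. ?g e)"
        using E(1) zero gc \<epsilon>E p by (intro add.finprod_mono_neutral_cong_right) auto
      also have "\<dots> = (\<Oplus>k\<in>{..<n p}. ?g (\<epsilon> (p, k)))"
        using gc \<epsilon>E p bij by (intro finsum_reindex) (auto simp: bij_betw_def inj_on_def)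
      also have "\<dots> = (\<Oplus>k\<in>{..<n p}. (v p i \<otimes> r \<otimes> u p k) \<otimes> (v p k \<otimes> s \<otimes> u p j))"
      proof (rule finsum_cong_simp[OF refl], unfold simp_implies_def)
        fix k assume "k \<in> {..<n p}"
        then have k: "k < n p" by simp
        \<comment> \<open>Factoring the inserted idempotent as u_k v_k splits the summand into two
          matrix entries.\<close>
        show "?g (\<epsilon> (p, k)) = (v p i \<otimes> r \<otimes> u p k) \<otimes> (v p k \<otimes> s \<otimes> u p j)"
          unfolding uv(7)[OF p k, symmetric]
          using uv(1,2)[OF p i] uv(1,2)[OF p j] uv(1,2)[OF p k] r s by (simp add: m_assoc)
      qed
      also have "\<dots> = (\<Oplus>\<^bsub>?D p\<^esub>k\<in>{..<n p}. (v p i \<otimes> r \<otimes> u p k) \<otimes> (v p k \<otimes> s \<otimes> u p j))"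
      proof (rule finsum_corner_ring[symmetric])
        interpret C: ring "?D p" using \<rho>[OF p] Ec by (intro ring_corner_ring) auto
        show "(\<lambda>k. (v p i \<otimes> r \<otimes> u p k) \<otimes> (v p k \<otimes> s \<otimes> u p j)) \<in> {..<n p} \<rightarrow> carrier (?D p)"
          using C.m_closed[OF entry[OF p i _ r] entry[OF p _ j s]] by auto
      qed (use \<rho>[OF p] Ec in auto)
      finally show ?thesis .
    qed
    then show "\<phi> p (r \<otimes> s) = \<phi> p r \<otimes>\<^bsub>?M p\<^esub> \<phi> p s"
      unfolding matrix_ring_simps \<phi>_def by (intro eq_matI) (auto cong: finsum_cong_simp)
    show "\<phi> p (r \<oplus> s) = \<phi> p r \<oplus>\<^bsub>?M p\<^esub> \<phi> p s"
      unfolding matrix_ring_simps \<phi>_def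
      using uv(1,2)[OF p] r s by (intro eq_matI) (auto simp: r_distr l_distr)
  next
    show "\<phi> p \<one> = \<one>\<^bsub>?M p\<^esub>"
      unfolding matrix_ring_simps \<phi>_def using uv(1,2)[OF p] vu[OF p _ p] by (intro eq_matI) auto
  qed
  define \<Phi> where "\<Phi> r = map (\<lambda>p. \<phi> p r) [0..<m]" for r
  have \<Phi>_hom: "\<Phi> \<in> Ring.ring_hom R (RDirProd_list (map ?M [0..<m]))"
    unfolding \<Phi>_def using hom by (intro ring_hom_RDirProd_list) auto
  have "inj_on \<Phi> (carrier R)"
  proof (rule inj_onI)
    fix r s assume r: "r \<in> carrier R" and s: "s \<in> carrier R" and eq: "\<Phi> r = \<Phi> s"
    have entry_eq: "v p i \<otimes> r \<otimes> u p j = v p i \<otimes> s \<otimes> u p j" if "p < m" "i < n p" "j < n p" for p i j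
    proof -
      have "\<Phi> r ! p $$ (i, j) = \<Phi> s ! p $$ (i, j)" by (simp add: eq)
      then show ?thesis using that by (simp add: \<Phi>_def \<phi>_def)
    qed
    \<comment> \<open>Within a class the Peirce component is recovered from the matrix entry as u_i
      (v_i t u_j) v_j; between classes it vanishes for r and s alike.\<close>
    have peirce: "e \<otimes> r \<otimes> f = e \<otimes> s \<otimes> f" if ef: "e \<in> E" "f \<in> E" for e f
    proof -
      obtain p i q j where p: "p < m" "i < n p" "e = \<epsilon> (p, i)" and q: "q < m" "j < n q" "f = \<epsilon> (q, j)"
        using ef bij by (auto simp: bij_betw_def)
      show ?thesis
      proof (cases "p = q")
        case True
        have "e \<otimes> t \<otimes> f = u p i \<otimes> (v p i \<otimes> t \<otimes> u p j) \<otimes> v p j" if "t \<in> carrier R" for t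
          using uv(1,2)[OF p(1,2)] uv(1,2)[of p j] uv(7)[OF p(1,2), symmetric] uv(7)[of p j, symmetric]
            that p q True by (simp add: m_assoc)
        then show ?thesis using entry_eq[of p i j] p q r s True by simp
      next
        case False
        then have "(e, f) \<notin> link" using link_iff p q by auto
        then show ?thesis using linkI ef r s by metis
      qed
    qed
    have left: "e \<otimes> r = e \<otimes> s" if "e \<in> E" for e
      using insert_one[of "e \<otimes> r" \<one>] insert_one[of "e \<otimes> s" \<one>] peirce[OF that] that Ec(1) r s
      by (simp cong: finsum_cong_simp)
    show "r = s"
      using insert_one[of \<one> r] insert_one[of \<one> s] left Ec(1) r s by (simp cong: finsum_cong_simp)
  qed
  moreover have "\<Phi> ` carrier R = carrier (RDirProd_list (map ?M [0..<m]))"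
  proof
    show "\<Phi> ` carrier R \<subseteq> carrier (RDirProd_list (map ?M [0..<m]))"
      using \<Phi>_hom by (auto simp: ring_hom_closed)
    show "carrier (RDirProd_list (map ?M [0..<m])) \<subseteq> \<Phi> ` carrier R"
    proof
      fix As assume As: "As \<in> carrier (RDirProd_list (map ?M [0..<m]))"
      have len: "length As = m" using RDirProd_list_carrier_mem(1)[OF As] by simp
      have Ap: "As ! p \<in> carrier (?M p)" if "p < m" for p
        using RDirProd_list_carrier_mem(2)[OF As, of p] that by simp
      define a where "a p i j = As ! p $$ (i, j)" for p i j
      have ac: "a p i j \<in> carrier R" "\<rho> p \<otimes> a p i j = a p i j" "a p i j \<otimes> \<rho> p = a p i j"
        if "p < m" "i < n p" "j < n p" for p i j
        using Ap[OF that(1)] that by (auto simp: a_def matrix_ring_carrier)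
      \<comment> \<open>The preimage carries each entry back to its Peirce component; by duality,
        multiplying by v_k on the left and u_l on the right leaves exactly the (k, l) entry of the
        block.\<close>
      define r where "r = (\<Oplus>p\<in>{..<m}. \<Oplus>i\<in>{..<n p}. \<Oplus>j\<in>{..<n p}. u p i \<otimes> a p i j \<otimes> v p j)"
      have summand: "u p i \<otimes> a p i j \<otimes> v p j \<in> carrier R" if "p < m" "i < n p" "j < n p" for p i j
        using that uv(1,2) ac(1) by simp
      have r: "r \<in> carrier R"
        unfolding r_def using summand by (auto intro!: finsum_closed)
      have "v q k \<otimes> r \<otimes> u q l = a q k l" if q: "q < m" and k: "k < n q" and l: "l < n q" for q k l
      proof -
        note vq = uv(2)[OF q k] and uq = uv(1)[OF q l]
        have sandwich: "v q k \<otimes> finsum R f A \<otimes> u q l = (\<Oplus>x\<in>A. v q k \<otimes> f x \<otimes> u q l)"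
          if "finite A" "f \<in> A \<rightarrow> carrier R" for f :: "nat \<Rightarrow> 'a" and A
          using that vq uq by (simp add: finsum_rdistr finsum_ldistr Pi_iff)
        have single: "v q k \<otimes> (u p i \<otimes> a p i j \<otimes> v p j) \<otimes> u q l =
            (if p = q \<and> i = k \<and> j = l then a q k l else \<zero>)"
          if p: "p < m" and i: "i < n p" and j: "j < n p" for p i j
        proof -
          have "v q k \<otimes> (u p i \<otimes> a p i j \<otimes> v p j) \<otimes> u q l =
              (v q k \<otimes> u p i) \<otimes> a p i j \<otimes> (v p j \<otimes> u q l)"
            using vq uq uv(1,2)[OF p i] uv(1,2)[OF p j] ac(1)[OF p i j] by (simp add: m_assoc)
          then show ?thesis
            using vu[OF q k p i] vu[OF p j q l] ac[OF p i j] Ec(1)[OF \<rho>[OF q]] by auto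
        qed
        have "v q k \<otimes> r \<otimes> u q l =
            (\<Oplus>p\<in>{..<m}. \<Oplus>i\<in>{..<n p}. \<Oplus>j\<in>{..<n p}. v q k \<otimes> (u p i \<otimes> a p i j \<otimes> v p j) \<otimes> u q l)"
          unfolding r_def using summand by (simp add: sandwich Pi_iff finsum_closed cong: finsum_cong_simp)
        also have "\<dots> = (\<Oplus>p\<in>{..<m}. \<Oplus>i\<in>{..<n p}. \<Oplus>j\<in>{..<n p}. if p = q \<and> i = k \<and> j = l then a q k l else \<zero>)"
          by (simp add: single cong: finsum_cong_simp)
        also have "\<dots> = (\<Oplus>i\<in>{..<n q}. \<Oplus>j\<in>{..<n q}. if i = k \<and> j = l then a q k l else \<zero>)"
          using q ac(1)[OF q k l] by (subst finsum_single[of _ q]) (auto intro!: finsum_closed)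
        also have "\<dots> = (\<Oplus>j\<in>{..<n q}. if j = l then a q k l else \<zero>)"
          using k ac(1)[OF q k l] by (subst finsum_single[of _ k]) (auto intro!: finsum_closed)
        also have "\<dots> = a q k l"
          using l ac(1)[OF q k l] by (subst finsum_single[of _ l]) auto
        finally show ?thesis .
      qed
      then have "\<phi> q r = As ! q" if "q < m" for q
        using Ap[OF that] that by (intro eq_matI) (auto simp: \<phi>_def a_def matrix_ring_carrier)
      then have "\<Phi> r = As" using len by (intro nth_equalityI) (auto simp: \<Phi>_def)
      then show "As \<in> \<Phi> ` carrier R" using r by auto
    qed
  qed
  ultimately have "\<Phi> \<in> ring_iso R (RDirProd_list (map ?M [0..<m]))"
    using \<Phi>_hom by (simp add: ring_iso_def bij_betw_def)
  then have "R \<simeq> RDirProd_list (map (\<lambda>(n, D). matrix_ring n D) (map (\<lambda>p. (n p, ?D p)) [0..<m]))"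
    unfolding is_ring_iso_def by (auto simp: comp_def)
  moreover have "1 \<le> k \<and> division_ring D"
    if "(k, D) \<in> set (map (\<lambda>p. (n p, ?D p)) [0..<m])" for k D
    using that n \<rho> E(2) division_ring_corner_ring by auto
  ultimately show ?thesis
    unfolding product_of_matrix_rings_def by (intro exI[of _ "map (\<lambda>p. (n p, ?D p)) [0..<m]"]) auto
qed

end

text \<open>Matrix products occur at two types because a formula cannot quantify over types: the
  type of \<open>R\<close>, where the corner rings live, serves for the equivalence, and a free type
  lets the division rings of a given product be arbitrary.\<close>

theorem theorem2p27:
  fixes R :: "('a, 'm) ring_scheme"
  assumes "ring R"
  shows
    "(semiprime_ring R \<and> right_endoartinian_ring R \<longleftrightarrow> semisimple_ring R) \<and>
     (semisimple_ring R \<longleftrightarrow> product_of_matrix_rings TYPE('a) R) \<and>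
     (product_of_matrix_rings TYPE('d) R \<longrightarrow> semisimple_ring R) \<and>
     (semisimple_ring R \<longleftrightarrow>
        right_hereditary_ring TYPE('c) R \<and>
        socle R (right_regular R) = carrier R \<and> finite_length R (right_regular R))"
proof -
  interpret ring R by fact
  have "semisimple_ring R \<longleftrightarrow> product_of_matrix_rings TYPE('a) R"
    using product_of_matrix_rings_if_orthogonal_idempotent_sum
      orthogonal_idempotent_sum_if_product_of_matrix_rings[where 'd = 'a]
    unfolding semisimple_iff_orthogonal_idempotent_sum by blast
  moreover have "product_of_matrix_rings TYPE('d) R \<longrightarrow> semisimple_ring R"
    using orthogonal_idempotent_sum_if_product_of_matrix_rings
    unfolding semisimple_iff_orthogonal_idempotent_sum by blast
  ultimately show ?thesis
    using semisimple_iff_semiprime_endoartinian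
      semisimple_iff_hereditary_socle_finite_length[where 'c = 'c]
    by meson
qed

end
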